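(* Let $(\mathfrak g,\langle\cdot,\cdot\rangle)$ be a $5$-dimensional metric Lie algebra whose center $\mathfrak z$ satisfies $\dim\mathfrak z>1$. If $(\mathfrak g,\langle\cdot,\cdot\rangle)$ admits a strict CKY tensor, then $(\mathfrak g,\langle\cdot,\cdot\rangle)$ is isometrically isomorphic to one and only one of the following metric Lie algebras (with one and only one choice of parameters): $(L_{5,9},\langle\cdot,\cdot\rangle_r)$ with $r>0$; $(\mathbb R^2\times\mathfrak{su}(2),\langle\cdot,\cdot\rangle_{r,s})$ with $s>r>0$; $(\mathbb R^2\times\mathfrak{sl}(2,\mathbb R),\langle\cdot,\cdot\rangle_{r,s})$ with $r>s>0$. Moreover, the CKY tensor is uniquely determined by the metric, up to scaling, and its associated $2$-form is, up to scaling, respectively: for $(L_{5,9},\langle\cdot,\cdot\rangle_r)$: $$6r^3\,z^1\wedge z^2-2r(z^1\wedge x^*+z^2\wedge y^* )+\tfrac4r\,x^*\wedge y^*;$$ for $(\mathbb R^2\times\mathfrak{su}(2),\langle\cdot,\cdot\rangle_{r,s})$: $$\frac{2(s^2+2r^2)}{r^2s}z^1\wedge z^2-\frac{6r}{(s^2-r^2)^{3/2}}(z^1\wedge y^*+z^2\wedge x^* )-\frac{2(s^4+2r^4)}{s(s^2-r^2)^3}x^*\wedge y^*;$$ for $(\mathbb R^2\times\mathfrak{sl}(2,\mathbb R),\langle\cdot,\cdot\rangle_{r,s})$: $$\frac{2(s^2+2r^2)}{r^2s}z^1\wedge z^2+\frac{6r}{(r^2-s^2)^{3/2}}(z^1\wedge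 y^*-z^2\wedge x^* )-\frac{2(s^4+2r^4)}{s(s^2-r^2)^3}x^*\wedge y^*.$$
   Context: A metric Lie algebra $(\mathfrak g,\langle\cdot,\cdot\rangle)$ is a finite-dimensional real Lie algebra with an inner product. Its Levi-Civita connection is given by $2\langle\nabla_xy,z\rangle=\langle[x,y],z\rangle-\langle[y,z],x\rangle+\langle[z,x],y\rangle$, and $(\nabla_xT)y=\nabla_x(Ty)-T(\nabla_xy)$. A CKY (conformal Killing-Yano) tensor is a skew-symmetric endomorphism $T$ of $\mathfrak g$ for which there is $\theta\in\mathfrak g^*$ with $$\langle(\nabla_xT)y,z\rangle+\langle(\nabla_yT)x,z\rangle=2\langle x,y\rangle\theta(z)-\langle y,z\rangle\theta(x)-\langle x,z\rangle\theta(y)\quad\text{for all }x,y,z\in\mathfrak g;$$ $\theta$ is unique, and $T$ is strict if $\theta\ne0$. The $2$-form associated to $T$ is $\omega(x,y)=\langle Tx,y\rangle$. An isometric isomorphism is a Lie algebra isomorphism preserving inner products. "Up to scaling" means up to a non-zero real factor. All three Lie algebras have a basis $\{E,Z_1,Z_2,X,Y\}$ with $Z_1,Z_2$ central, with dual basis denoted $\{e,z^1,z^2,x^*,y^*\}$ (so $e(E)=z^1(Z_1)=z^2(Z_2)=x^*(X)=y^*(Y)=1$, other pairings $0$); unlisted brackets and inner products of basis vectors are zero. $L_{5,9}$: $[X,E]=Z_1$, $[Y,E]=Z_2$, $[X,Y]=E$. The metric $\langle\cdot,\cdot\rangle_r$ is diagonal with $\|E\|^2=r^2$, $\|Z_1\|^2=\|Z_2\|^2=r^4$,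 $\|X\|^2=\|Y\|^2=1$. $\mathbb R^2\times\mathfrak{su}(2)$: $[E,X]=Y$, $[X,Y]=E$, $[Y,E]=X$. With $a_4=\frac{s^2-r^2}{s}>0$, the metric $\langle\cdot,\cdot\rangle_{r,s}$ is: $\|E\|^2=\frac1{a_4^2}$, $\|Z_1\|^2=\|Z_2\|^2=1$, $\|X\|^2=\|Y\|^2=\frac{r^2+a_4^2}{a_4^3s}$, $\langle Z_1,X\rangle=\frac{r}{\sqrt{a_4^3s}}$, $\langle Z_2,Y\rangle=-\frac{r}{\sqrt{a_4^3s}}$. $\mathbb R^2\times\mathfrak{sl}(2,\mathbb R)$: $[E,X]=Y$, $[X,Y]=-E$, $[Y,E]=X$. With $a_4=\frac{s^2-r^2}{s}<0$, the metric $\langle\cdot,\cdot\rangle_{r,s}$ is: $\|E\|^2=\frac1{a_4^2}$, $\|Z_1\|^2=\|Z_2\|^2=1$, $\|X\|^2=\|Y\|^2=\frac{r^2+a_4^2}{|a_4|^3s}$, $\langle Z_1,X\rangle=\langle Z_2,Y\rangle=\frac{r}{\sqrt{|a_4|^3s}}$. *)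

theory Defs
  imports "HOL-Analysis.Analysis"
begin

definition lie_bracket :: "('a::real_vector \<Rightarrow> 'a \<Rightarrow> 'a) \<Rightarrow> bool" where
  "lie_bracket br \<longleftrightarrow> bilinear br \<and> (\<forall>x. br x x = 0) \<and>
     (\<forall>x y z. br x (br y z) + br y (br z x) + br z (br x y) = 0)"

definition inner_product :: "('a::real_vector \<Rightarrow> 'a \<Rightarrow> real) \<Rightarrow> bool" where
  "inner_product ip \<longleftrightarrow> bilinear ip \<and> (\<forall>x y. ip x y = ip y x) \<and> (\<forall>x. x \<noteq> 0 \<longrightarrow> ip x x > 0)"

definition metric_lie_algebra :: "('a::real_vector \<Rightarrow> 'a \<Rightarrow> 'a) \<Rightarrow> ('a \<Rightarrow> 'a \<Rightarrow> real) \<Rightarrow> bool" where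
  "metric_lie_algebra br ip \<longleftrightarrow>
     (\<exists>B::'a set. finite B \<and> span B = UNIV) \<and> lie_bracket br \<and> inner_product ip"

definition lie_center :: "('a::real_vector \<Rightarrow> 'a \<Rightarrow> 'a) \<Rightarrow> 'a set" where
  "lie_center br = {z. \<forall>x. br z x = 0}"

(* Well defined for every metric Lie algebra: in finite dimension the inner product is
   nondegenerate, so the Koszul formula determines the vector uniquely. *)
definition levi_civita ::
    "('a::real_vector \<Rightarrow> 'a \<Rightarrow> 'a) \<Rightarrow> ('a \<Rightarrow> 'a \<Rightarrow> real) \<Rightarrow> 'a \<Rightarrow> 'a \<Rightarrow> 'a" where
  "levi_civita br ip x y =
     (THE w. \<forall>z. 2 * ip w z = ip (br x y) z - ip (br y z) x + ip (br z x) y)"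

definition cov_deriv ::
    "('a::real_vector \<Rightarrow> 'a \<Rightarrow> 'a) \<Rightarrow> ('a \<Rightarrow> 'a \<Rightarrow> real) \<Rightarrow> 'a \<Rightarrow> ('a \<Rightarrow> 'a) \<Rightarrow> 'a \<Rightarrow> 'a" where
  "cov_deriv br ip x T y = levi_civita br ip x (T y) - T (levi_civita br ip x y)"

definition skew_endo :: "('a::real_vector \<Rightarrow> 'a \<Rightarrow> real) \<Rightarrow> ('a \<Rightarrow> 'a) \<Rightarrow> bool" where
  "skew_endo ip T \<longleftrightarrow> linear T \<and> (\<forall>x y. ip (T x) y = - ip x (T y))"

definition cky_with ::
    "('a::real_vector \<Rightarrow> 'a \<Rightarrow> 'a) \<Rightarrow> ('a \<Rightarrow> 'a \<Rightarrow> real) \<Rightarrow> ('a \<Rightarrow> 'a) \<Rightarrow> ('a \<Rightarrow> real) \<Rightarrow> bool" where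
  "cky_with br ip T \<theta> \<longleftrightarrow> skew_endo ip T \<and> linear \<theta> \<and>
     (\<forall>x y z. ip (cov_deriv br ip x T y) z + ip (cov_deriv br ip y T x) z
        = 2 * ip x y * \<theta> z - ip y z * \<theta> x - ip x z * \<theta> y)"

definition cky_tensor ::
    "('a::real_vector \<Rightarrow> 'a \<Rightarrow> 'a) \<Rightarrow> ('a \<Rightarrow> 'a \<Rightarrow> real) \<Rightarrow> ('a \<Rightarrow> 'a) \<Rightarrow> bool" where
  "cky_tensor br ip T \<longleftrightarrow> (\<exists>\<theta>. cky_with br ip T \<theta>)"

definition strict_cky_tensor ::
    "('a::real_vector \<Rightarrow> 'a \<Rightarrow> 'a) \<Rightarrow> ('a \<Rightarrow> 'a \<Rightarrow> real) \<Rightarrow> ('a \<Rightarrow> 'a) \<Rightarrow> bool" where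
  "strict_cky_tensor br ip T \<longleftrightarrow> (\<exists>\<theta>. cky_with br ip T \<theta> \<and> (\<exists>x. \<theta> x \<noteq> 0))"

definition assoc_form ::
    "('a::real_vector \<Rightarrow> 'a \<Rightarrow> real) \<Rightarrow> ('a \<Rightarrow> 'a) \<Rightarrow> 'a \<Rightarrow> 'a \<Rightarrow> real" where
  "assoc_form ip T x y = ip (T x) y"

definition isometric_isomorphism ::
    "('a::real_vector \<Rightarrow> 'a \<Rightarrow> 'a) \<Rightarrow> ('a \<Rightarrow> 'a \<Rightarrow> real) \<Rightarrow>
     ('b::real_vector \<Rightarrow> 'b \<Rightarrow> 'b) \<Rightarrow> ('b \<Rightarrow> 'b \<Rightarrow> real) \<Rightarrow> ('a \<Rightarrow> 'b) \<Rightarrow> bool" where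
  "isometric_isomorphism br ip br' ip' \<phi> \<longleftrightarrow> linear \<phi> \<and> bij \<phi> \<and>
     (\<forall>x y. \<phi> (br x y) = br' (\<phi> x) (\<phi> y)) \<and> (\<forall>x y. ip' (\<phi> x) (\<phi> y) = ip x y)"

definition isometrically_isomorphic ::
    "('a::real_vector \<Rightarrow> 'a \<Rightarrow> 'a) \<Rightarrow> ('a \<Rightarrow> 'a \<Rightarrow> real) \<Rightarrow>
     ('b::real_vector \<Rightarrow> 'b \<Rightarrow> 'b) \<Rightarrow> ('b \<Rightarrow> 'b \<Rightarrow> real) \<Rightarrow> bool" where
  "isometrically_isomorphic br ip br' ip' \<longleftrightarrow> (\<exists>\<phi>. isometric_isomorphism br ip br' ip' \<phi>)"

datatype idx = iE | iZ1 | iZ2 | iX | iY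

lemma UNIV_idx: "UNIV = {iE, iZ1, iZ2, iX, iY}"
  by (auto intro: idx.exhaust)

instance idx :: finite
  by standard (simp add: UNIV_idx)

type_synonym vec5 = "real ^ idx"

abbreviation bvec :: "idx \<Rightarrow> vec5" where "bvec i \<equiv> axis i 1"

abbreviation (input) dual :: "idx \<Rightarrow> vec5 \<Rightarrow> real" where "dual i \<equiv> \<lambda>u. u $ i"

definition wedge :: "('a \<Rightarrow> real) \<Rightarrow> ('a \<Rightarrow> real) \<Rightarrow> 'a \<Rightarrow> 'a \<Rightarrow> real" where
  "wedge \<alpha> \<beta> u v = \<alpha> u * \<beta> v - \<alpha> v * \<beta> u"

(* A bracket table has an entry for only one of each pair (i, j), (j, i); the bracket of the
   basis vectors i and j is c i j - c j i, extended bilinearly. *)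
definition bracket_of :: "(idx \<Rightarrow> idx \<Rightarrow> vec5) \<Rightarrow> vec5 \<Rightarrow> vec5 \<Rightarrow> vec5" where
  "bracket_of c u v = (\<Sum>i\<in>UNIV. \<Sum>j\<in>UNIV. (u $ i * v $ j) *\<^sub>R (c i j - c j i))"

definition metric_of :: "(idx \<Rightarrow> idx \<Rightarrow> real) \<Rightarrow> vec5 \<Rightarrow> vec5 \<Rightarrow> real" where
  "metric_of g u v = (\<Sum>i\<in>UNIV. \<Sum>j\<in>UNIV. u $ i * v $ j * g i j)"

fun L59_table :: "idx \<Rightarrow> idx \<Rightarrow> vec5" where
  "L59_table iX iE = bvec iZ1"
| "L59_table iY iE = bvec iZ2"
| "L59_table iX iY = bvec iE"
| "L59_table _ _ = 0"

fun su2_table :: "idx \<Rightarrow> idx \<Rightarrow> vec5" where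
  "su2_table iE iX = bvec iY"
| "su2_table iX iY = bvec iE"
| "su2_table iY iE = bvec iX"
| "su2_table _ _ = 0"

fun sl2_table :: "idx \<Rightarrow> idx \<Rightarrow> vec5" where
  "sl2_table iE iX = bvec iY"
| "sl2_table iX iY = - bvec iE"
| "sl2_table iY iE = bvec iX"
| "sl2_table _ _ = 0"

definition a4 :: "real \<Rightarrow> real \<Rightarrow> real" where
  "a4 r s = (s^2 - r^2) / s"

fun L59_gram :: "real \<Rightarrow> idx \<Rightarrow> idx \<Rightarrow> real" where
  "L59_gram r iE iE = r^2"
| "L59_gram r iZ1 iZ1 = r^4"
| "L59_gram r iZ2 iZ2 = r^4"
| "L59_gram r iX iX = 1"
| "L59_gram r iY iY = 1"
| "L59_gram r _ _ = 0"

fun su2_gram :: "real \<Rightarrow> real \<Rightarrow> idx \<Rightarrow> idx \<Rightarrow> real" where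
  "su2_gram r s iE iE = 1 / (a4 r s)^2"
| "su2_gram r s iZ1 iZ1 = 1"
| "su2_gram r s iZ2 iZ2 = 1"
| "su2_gram r s iX iX = (r^2 + (a4 r s)^2) / ((a4 r s)^3 * s)"
| "su2_gram r s iY iY = (r^2 + (a4 r s)^2) / ((a4 r s)^3 * s)"
| "su2_gram r s iZ1 iX = r / sqrt ((a4 r s)^3 * s)"
| "su2_gram r s iX iZ1 = r / sqrt ((a4 r s)^3 * s)"
| "su2_gram r s iZ2 iY = - (r / sqrt ((a4 r s)^3 * s))"
| "su2_gram r s iY iZ2 = - (r / sqrt ((a4 r s)^3 * s))"
| "su2_gram r s _ _ = 0"

fun sl2_gram :: "real \<Rightarrow> real \<Rightarrow> idx \<Rightarrow> idx \<Rightarrow> real" where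
  "sl2_gram r s iE iE = 1 / (a4 r s)^2"
| "sl2_gram r s iZ1 iZ1 = 1"
| "sl2_gram r s iZ2 iZ2 = 1"
| "sl2_gram r s iX iX = (r^2 + (a4 r s)^2) / (\<bar>a4 r s\<bar>^3 * s)"
| "sl2_gram r s iY iY = (r^2 + (a4 r s)^2) / (\<bar>a4 r s\<bar>^3 * s)"
| "sl2_gram r s iZ1 iX = r / sqrt (\<bar>a4 r s\<bar>^3 * s)"
| "sl2_gram r s iX iZ1 = r / sqrt (\<bar>a4 r s\<bar>^3 * s)"
| "sl2_gram r s iZ2 iY = r / sqrt (\<bar>a4 r s\<bar>^3 * s)"
| "sl2_gram r s iY iZ2 = r / sqrt (\<bar>a4 r s\<bar>^3 * s)"
| "sl2_gram r s _ _ = 0"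

(* A model is one of the three families together with its parameters, so that uniqueness of a
   model is uniqueness of both the Lie algebra and the parameters. *)
datatype model = L59 real | R2_su2 real real | R2_sl2 real real

fun admissible :: "model \<Rightarrow> bool" where
  "admissible (L59 r) \<longleftrightarrow> r > 0"
| "admissible (R2_su2 r s) \<longleftrightarrow> s > r \<and> r > 0"
| "admissible (R2_sl2 r s) \<longleftrightarrow> r > s \<and> s > 0"

fun model_bracket :: "model \<Rightarrow> vec5 \<Rightarrow> vec5 \<Rightarrow> vec5" where
  "model_bracket (L59 r) = bracket_of L59_table"
| "model_bracket (R2_su2 r s) = bracket_of su2_table"
| "model_bracket (R2_sl2 r s) = bracket_of sl2_table"

fun model_metric :: "model \<Rightarrow> vec5 \<Rightarrow> vec5 \<Rightarrow> real" where
  "model_metric (L59 r) = metric_of (L59_gram r)"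
| "model_metric (R2_su2 r s) = metric_of (su2_gram r s)"
| "model_metric (R2_sl2 r s) = metric_of (sl2_gram r s)"

fun model_form :: "model \<Rightarrow> vec5 \<Rightarrow> vec5 \<Rightarrow> real" where
  "model_form (L59 r) u v =
     6 * r^3 * wedge (dual iZ1) (dual iZ2) u v
     - 2 * r * (wedge (dual iZ1) (dual iX) u v + wedge (dual iZ2) (dual iY) u v)
     + 4 / r * wedge (dual iX) (dual iY) u v"
| "model_form (R2_su2 r s) u v =
     2 * (s^2 + 2 * r^2) / (r^2 * s) * wedge (dual iZ1) (dual iZ2) u v
     - 6 * r / (s^2 - r^2) powr (3/2)
         * (wedge (dual iZ1) (dual iY) u v + wedge (dual iZ2) (dual iX) u v)
     - 2 * (s^4 + 2 * r^4) / (s * (s^2 - r^2)^3) * wedge (dual iX) (dual iY) u v"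
| "model_form (R2_sl2 r s) u v =
     2 * (s^2 + 2 * r^2) / (r^2 * s) * wedge (dual iZ1) (dual iZ2) u v
     + 6 * r / (r^2 - s^2) powr (3/2)
         * (wedge (dual iZ1) (dual iY) u v - wedge (dual iZ2) (dual iX) u v)
     - 2 * (s^4 + 2 * r^4) / (s * (s^2 - r^2)^3) * wedge (dual iX) (dual iY) u v"

lemma sum_idx: "(\<Sum>i\<in>UNIV. f i) = f iE + f iZ1 + f iZ2 + f iX + f iY"
  for f :: "idx \<Rightarrow> 'b::comm_monoid_add"
  by (simp add: UNIV_idx ac_simps)

lemma all_idx: "(\<forall>i. P i) \<longleftrightarrow> P iE \<and> P iZ1 \<and> P iZ2 \<and> P iX \<and> P iY"
  by (metis idx.exhaust)

lemma bilinear_bracket_of: "bilinear (bracket_of c)"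
  unfolding bilinear_def bracket_of_def
  by (auto intro!: linearI simp: algebra_simps sum.distrib sum_subtractf scaleR_sum_right)

lemma bilinear_metric_of: "bilinear (metric_of g)"
  unfolding bilinear_def metric_of_def
  by (auto intro!: linearI simp: algebra_simps sum.distrib sum_distrib_left)

lemma lie_bracket_model: "lie_bracket (model_bracket m)"
  by (cases m; simp add: lie_bracket_def bilinear_bracket_of;
      simp add: bracket_of_def vec_eq_iff all_idx sum_idx axis_def algebra_simps)

lemma two_by_two_pos:
  fixes q l a b c d :: real
  assumes "l > q^2"
  shows "a^2 + 2*q*a*b + l*b^2 \<ge> 0"
    and "a^2 + 2*q*a*b + l*b^2 = 0 \<Longrightarrow> a = 0 \<and> b = 0"
proof -
  have eq: "a^2 + 2*q*a*b + l*b^2 = (a + q*b)^2 + (l - q^2)*b^2"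
    by (simp add: power2_eq_square algebra_simps)
  have nn: "(l - q^2)*b^2 \<ge> 0" using assms by simp
  then show "a^2 + 2*q*a*b + l*b^2 \<ge> 0" unfolding eq by simp
  assume "a^2 + 2*q*a*b + l*b^2 = 0"
  then have "(a + q*b)^2 = 0 \<and> (l - q^2)*b^2 = 0"
    unfolding eq using nn by (simp add: add_nonneg_eq_0_iff)
  then show "a = 0 \<and> b = 0" using assms by auto
qed

lemma sqrt_div_sq: "d > 0 \<Longrightarrow> (r / sqrt d)^2 = r^2 / d" for r d :: real
  by (simp add: power_divide)

lemma inner_product_block:
  fixes q e l k :: real
  assumes "e > 0" "l > q^2" "k^2 = q^2"
  assumes g: "g iE iE = e" "g iZ1 iZ1 = 1" "g iZ2 iZ2 = 1" "g iX iX = l" "g iY iY = l"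
    "g iZ1 iX = q" "g iX iZ1 = q" "g iZ2 iY = k" "g iY iZ2 = k"
    "g iE iZ1 = 0" "g iE iZ2 = 0" "g iE iX = 0" "g iE iY = 0" "g iZ1 iE = 0" "g iZ1 iZ2 = 0"
    "g iZ1 iY = 0" "g iZ2 iE = 0" "g iZ2 iZ1 = 0" "g iZ2 iX = 0" "g iX iE = 0" "g iX iZ2 = 0"
    "g iX iY = 0" "g iY iE = 0" "g iY iZ1 = 0" "g iY iX = 0"
  shows "inner_product (metric_of g)"
proof -
  have sym: "metric_of g x y = metric_of g y x" for x y
    by (simp add: metric_of_def sum_idx g algebra_simps)
  have pos: "metric_of g x x > 0" if "x \<noteq> 0" for x
  proof -
    let ?A = "(x$iZ1)^2 + 2*q*x$iZ1*x$iX + l*(x$iX)^2"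
    let ?B = "(x$iZ2)^2 + 2*k*x$iZ2*x$iY + l*(x$iY)^2"
    have eq: "metric_of g x x = e*(x$iE)^2 + ?A + ?B"
      by (simp add: metric_of_def sum_idx g algebra_simps power2_eq_square)
    have lk: "l > k^2" using assms by simp
    have nn: "e*(x$iE)^2 \<ge> 0" "?A \<ge> 0" "?B \<ge> 0"
      using assms(1) two_by_two_pos(1)[OF assms(2)] two_by_two_pos(1)[OF lk] by auto
    have "metric_of g x x \<noteq> 0"
    proof
      assume "metric_of g x x = 0"
      then have z: "e*(x$iE)^2 = 0" "?A = 0" "?B = 0"
        unfolding eq using nn by linarith+
      have "x = 0"
        using z(1) assms(1) two_by_two_pos(2)[OF assms(2) z(2)] two_by_two_pos(2)[OF lk z(3)]
        by (simp add: vec_eq_iff all_idx)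
      with that show False by simp
    qed
    then show ?thesis unfolding eq using nn by linarith
  qed
  show ?thesis
    unfolding inner_product_def using bilinear_metric_of sym pos by blast
qed

lemma block_ineq:
  fixes r s a :: real
  assumes "a > 0" "s > 0"
  shows "(r / sqrt (a^3 * s))^2 < (r^2 + a^2) / (a^3 * s)"
  using assms by (simp add: sqrt_div_sq divide_strict_right_mono)

lemma inner_product_L59:
  assumes "r > 0" shows "inner_product (metric_of (L59_gram r))"
proof -
  have pos: "metric_of (L59_gram r) x x > 0" if "x \<noteq> 0" for x
  proof -
    have eq: "metric_of (L59_gram r) x x = (r*x$iE)^2 + (r^2*x$iZ1)^2 + (r^2*x$iZ2)^2
        + (x$iX)^2 + (x$iY)^2"
      by (simp add: metric_of_def sum_idx power2_eq_square power4_eq_xxxx)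
    have "metric_of (L59_gram r) x x \<noteq> 0"
      using that assms unfolding eq
      by (auto simp: add_nonneg_eq_0_iff vec_eq_iff all_idx)
    moreover have "metric_of (L59_gram r) x x \<ge> 0" unfolding eq by simp
    ultimately show ?thesis by linarith
  qed
  have "metric_of (L59_gram r) x y = metric_of (L59_gram r) y x" for x y
    by (simp add: metric_of_def sum_idx)
  with pos show ?thesis unfolding inner_product_def using bilinear_metric_of by blast
qed

lemma inner_product_model:
  assumes "admissible m" shows "inner_product (model_metric m)"
proof (cases m)
  case (L59 r)
  then show ?thesis using assms inner_product_L59 by simp
next
  case (R2_su2 r s)
  with assms have rs: "s > r" "r > 0" by auto
  then have "r^2 < s^2" by (simp add: power_strict_mono)
  then have a: "a4 r s > 0" using rs by (simp add: a4_def)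
  then have "inner_product (metric_of (su2_gram r s))"
    using inner_product_block[where g = "su2_gram r s" and e = "1 / (a4 r s)^2"
        and q = "r / sqrt ((a4 r s)^3 * s)" and k = "- (r / sqrt ((a4 r s)^3 * s))"
        and l = "(r^2 + (a4 r s)^2) / ((a4 r s)^3 * s)"]
      block_ineq[OF a, of s r] rs by simp
  then show ?thesis using R2_su2 by simp
next
  case (R2_sl2 r s)
  with assms have rs: "r > s" "s > 0" by auto
  then have "s^2 < r^2" by (simp add: power_strict_mono)
  then have a: "a4 r s < 0" using rs by (simp add: a4_def divide_neg_pos)
  then have "inner_product (metric_of (sl2_gram r s))"
    using inner_product_block[where g = "sl2_gram r s" and e = "1 / (a4 r s)^2"
        and q = "r / sqrt (\<bar>a4 r s\<bar>^3 * s)" and k = "r / sqrt (\<bar>a4 r s\<bar>^3 * s)"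
        and l = "(r^2 + (a4 r s)^2) / (\<bar>a4 r s\<bar>^3 * s)"]
      block_ineq[of "\<bar>a4 r s\<bar>" s r] rs by simp
  then show ?thesis using R2_sl2 by simp
qed

lemma metric_lie_algebra_model:
  assumes "admissible m" shows "metric_lie_algebra (model_bracket m) (model_metric m)"
  unfolding metric_lie_algebra_def
  using lie_bracket_model inner_product_model[OF assms] finite_Basis span_Basis by blast

end

theory Submission
  imports Defs
begin

text \<open>
  Let T be a strict CKY tensor with 1-form \<theta>. For a central z, the CKY equation at (z, z) shows that
  \<theta> vanishes on the centre (as the centre has dimension at least 2) and that T z is not contained
  in the sum of the centre and the line dual to \<theta>. This singles out an orthonormal frame in which E is
  dual to \<theta>, the vectors Z1, Z2 are central and X is the remaining part of T Z1. In this frame the CKY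
  equation is bilinear in the structure constants and the coefficients of T; solving it leaves only
  [E,X] = P Z1 + \<kappa> Y, [E,Y] = P Z2 - \<kappa> X, [X,Y] = u E with \<kappa> = (u^2 - P^2) / u, where P, u > 0 after
  changing signs. Conversely, in every such frame the CKY tensors form a line. The pair (P, u) is
  an isometry invariant, and the models realise each pair exactly once: P = u gives the nilpotent
  family, P < u the compact one and P > u the noncompact one.
\<close>

subsection \<open>The CKY equation in an orthonormal frame\<close>

text \<open>The right-hand side of the Koszul formula. Being an explicit trilinear form in brackets
  and inner products, it frees the CKY equation from the definite description in
  \<open>levi_civita\<close>.\<close>

definition koszul ::
    "('a::real_vector \<Rightarrow> 'a \<Rightarrow> 'a) \<Rightarrow> ('a \<Rightarrow> 'a \<Rightarrow> real) \<Rightarrow> 'a \<Rightarrow> 'a \<Rightarrow> 'a \<Rightarrow> real" where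
  "koszul br ip x y z = ip (br x y) z - ip (br y z) x + ip (br z x) y"

text \<open>The expansion axiom makes the orthonormal vectors a basis, so everything inside the
  locale is a computation with five coordinates and dimension arguments stay outside.\<close>

locale framed_algebra =
  fixes br :: "'a::real_vector \<Rightarrow> 'a \<Rightarrow> 'a" and ip :: "'a \<Rightarrow> 'a \<Rightarrow> real" and f :: "idx \<Rightarrow> 'a"
  assumes bilinear_br: "bilinear br"
    and br_self: "br x x = 0"
    and inner_product: "inner_product ip"
    and orthonormal: "ip (f i) (f j) = (if i = j then 1 else 0)"
    and expansion: "v = (\<Sum>i\<in>UNIV. ip v (f i) *\<^sub>R f i)"
begin

lemma bilinear_ip: "bilinear ip"
  using inner_product by (simp add: inner_product_def)

lemma ip_commute: "ip x y = ip y x"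
  using inner_product by (simp add: inner_product_def)

lemmas ip_linear =
  bilinear_ladd[OF bilinear_ip] bilinear_radd[OF bilinear_ip]
  bilinear_lmul[OF bilinear_ip] bilinear_rmul[OF bilinear_ip]
  bilinear_lneg[OF bilinear_ip] bilinear_rneg[OF bilinear_ip]
  bilinear_lsub[OF bilinear_ip] bilinear_rsub[OF bilinear_ip]
  bilinear_lzero[OF bilinear_ip] bilinear_rzero[OF bilinear_ip]

lemmas br_linear =
  bilinear_ladd[OF bilinear_br] bilinear_radd[OF bilinear_br]
  bilinear_lmul[OF bilinear_br] bilinear_rmul[OF bilinear_br]
  bilinear_lneg[OF bilinear_br] bilinear_rneg[OF bilinear_br]
  bilinear_lsub[OF bilinear_br] bilinear_rsub[OF bilinear_br]
  bilinear_lzero[OF bilinear_br] bilinear_rzero[OF bilinear_br]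

lemma br_anti: "br x y = - br y x"
proof -
  have "br (x + y) (x + y) = br x y + br y x"
    by (simp only: br_linear) (simp add: br_self)
  then have "br x y + br y x = 0" by (simp add: br_self)
  then show ?thesis by (simp add: eq_neg_iff_add_eq_0)
qed

lemma expansion_idx:
  "v = ip v (f iE) *\<^sub>R f iE + ip v (f iZ1) *\<^sub>R f iZ1 + ip v (f iZ2) *\<^sub>R f iZ2
     + ip v (f iX) *\<^sub>R f iX + ip v (f iY) *\<^sub>R f iY"
  using expansion[of v] by (simp add: sum_idx)

lemma linear_expand:
  fixes g :: "'a \<Rightarrow> 'b::real_vector"
  assumes "linear g" shows "g v = (\<Sum>i\<in>UNIV. ip v (f i) *\<^sub>R g (f i))"
  by (subst expansion[of v]) (simp add: linear_sum[OF assms] linear_scale[OF assms])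

lemma linear_zeroI:
  fixes g :: "'a \<Rightarrow> 'b::real_vector"
  assumes "linear g" "\<And>i. g (f i) = 0" shows "g v = 0"
  using linear_expand[OF assms(1), of v] assms(2) by simp

lemma vector_eqI:
  assumes "\<And>i. ip v (f i) = ip w (f i)" shows "v = w"
  using expansion[of v] expansion[of w] assms by simp

lemma ip_expand: "ip v w = (\<Sum>i\<in>UNIV. ip v (f i) * ip w (f i))"
  using linear_expand[of "ip v" w] bilinear_ip
  by (simp add: bilinear_def mult.commute)

lemma koszul_linear:
  "linear (\<lambda>x. koszul br ip x y z)" "linear (\<lambda>y. koszul br ip x y z)"
  "linear (\<lambda>z. koszul br ip x y z)"
  by (auto intro!: linearI simp: koszul_def br_linear ip_linear algebra_simps)

text \<open>The Koszul form is linear in z, hence represented by the vector whose coordinates are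
  half its values on the frame. A vector is determined by its coordinates, so the description in
  \<open>levi_civita\<close> denotes this one.\<close>

lemma levi_civita_koszul: "2 * ip (levi_civita br ip x y) z = koszul br ip x y z"
proof -
  define w where "w = (\<Sum>i\<in>UNIV. (koszul br ip x y (f i) / 2) *\<^sub>R f i)"
  have w: "2 * ip w z = koszul br ip x y z" for z
  proof -
    have "ip w z = (\<Sum>i\<in>UNIV. (koszul br ip x y (f i) / 2) * ip (f i) z)"
      unfolding w_def by (simp add: bilinear_ip[unfolded bilinear_def, THEN conjunct2, rule_format, THEN linear_sum]
          sum_idx ip_linear)
    then show ?thesis
      by (simp add: sum_idx linear_expand[OF koszul_linear(3), of x y z] ip_commute[of _ z])
  qed
  have "levi_civita br ip x y = w"
    unfolding levi_civita_def
  proof (rule the_equality)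
    show "\<forall>z. 2 * ip w z = ip (br x y) z - ip (br y z) x + ip (br z x) y"
      using w by (simp add: koszul_def)
    fix w' assume "\<forall>z. 2 * ip w' z = ip (br x y) z - ip (br y z) x + ip (br z x) y"
    then have "2 * ip w' z = 2 * ip w z" for z using w by (simp add: koszul_def)
    then show "w' = w" by (intro vector_eqI) simp
  qed
  with w show ?thesis by simp
qed

text \<open>Skewness turns the term in which T follows the connection into a pairing of the
  connection with \<open>T z\<close>.\<close>

lemma cov_deriv_koszul:
  assumes "skew_endo ip T"
  shows "2 * ip (cov_deriv br ip x T y) z = koszul br ip x (T y) z + koszul br ip x y (T z)"
proof -
  have "ip (T a) b = - ip a (T b)" for a b using assms by (simp add: skew_endo_def)
  then show ?thesis
    by (simp add: cov_deriv_def ip_linear levi_civita_koszul[symmetric])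
qed

lemma cky_with_iff:
  "cky_with br ip T \<theta> \<longleftrightarrow> skew_endo ip T \<and> linear \<theta> \<and>
     (\<forall>x y z. koszul br ip x (T y) z + koszul br ip x y (T z)
            + koszul br ip y (T x) z + koszul br ip y x (T z)
        = 2 * (2 * ip x y * \<theta> z - ip y z * \<theta> x - ip x z * \<theta> y))"
proof (cases "skew_endo ip T")
  case True
  have "koszul br ip x (T y) z + koszul br ip x y (T z)
            + koszul br ip y (T x) z + koszul br ip y x (T z) = 2 * R
      \<longleftrightarrow> ip (cov_deriv br ip x T y) z + ip (cov_deriv br ip y T x) z = R" for x y z R
    using cov_deriv_koszul[OF True, of x y z] cov_deriv_koszul[OF True, of y x z] by auto
  then show ?thesis by (simp only: cky_with_def)
qed (simp add: cky_with_def)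

text \<open>The defect \<open>D\<close> of the equation is linear in each of its three arguments, so
  vanishing on frame triples suffices.\<close>

lemma cky_with_frameI:
  assumes "skew_endo ip T" "linear \<theta>"
    and "\<And>i j k. koszul br ip (f i) (T (f j)) (f k) + koszul br ip (f i) (f j) (T (f k))
            + koszul br ip (f j) (T (f i)) (f k) + koszul br ip (f j) (f i) (T (f k))
        = 2 * (2 * ip (f i) (f j) * \<theta> (f k) - ip (f j) (f k) * \<theta> (f i) - ip (f i) (f k) * \<theta> (f j))"
  shows "cky_with br ip T \<theta>"
proof -
  have T: "T (a + b) = T a + T b" "T (c *\<^sub>R a) = c *\<^sub>R T a" for a b c
    using assms(1) by (auto simp: skew_endo_def linear_add linear_scale)
  have \<theta>: "\<theta> (a + b) = \<theta> a + \<theta> b" "\<theta> (c *\<^sub>R a) = c * \<theta> a" for a b c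
    using assms(2) by (auto simp: linear_add linear_scale)
  define D where "D x y z = koszul br ip x (T y) z + koszul br ip x y (T z)
            + koszul br ip y (T x) z + koszul br ip y x (T z)
            - 2 * (2 * ip x y * \<theta> z - ip y z * \<theta> x - ip x z * \<theta> y)" for x y z
  have lin: "linear (\<lambda>x. D x y z)" "linear (\<lambda>y. D x y z)" "linear (\<lambda>z. D x y z)" for x y z
    by (auto intro!: linearI simp: D_def koszul_def T \<theta> br_linear ip_linear algebra_simps)
  have "D (f i) (f j) (f k) = 0" for i j k using assms(3) by (simp add: D_def)
  then have "D (f i) (f j) z = 0" for i j z by (rule linear_zeroI[OF lin(3)])
  then have "D (f i) y z = 0" for i y z by (rule linear_zeroI[OF lin(2)])
  then have "D x y z = 0" for x y z by (rule linear_zeroI[OF lin(1)])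
  then show ?thesis using assms(1,2) by (simp add: cky_with_iff D_def)
qed

text \<open>One scalar equation per index triple, bilinear in the coefficients of T and the
  structure constants, with values of \<theta> on the right. These are the equations solved twice
  below.\<close>

lemma cky_frame:
  assumes "cky_with br ip T \<theta>"
  shows "(\<Sum>l\<in>UNIV. ip (T (f j)) (f l) * koszul br ip (f i) (f l) (f k)
            + ip (T (f k)) (f l) * koszul br ip (f i) (f j) (f l)
            + ip (T (f i)) (f l) * koszul br ip (f j) (f l) (f k)
            + ip (T (f k)) (f l) * koszul br ip (f j) (f i) (f l))
        = 2 * (2 * ip (f i) (f j) * \<theta> (f k) - ip (f j) (f k) * \<theta> (f i) - ip (f i) (f k) * \<theta> (f j))"
proof -
  have "koszul br ip x (T y) z = (\<Sum>l\<in>UNIV. ip (T y) (f l) * koszul br ip x (f l) z)" for x y z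
    by (rule linear_expand[OF koszul_linear(2), unfolded real_scaleR_def])
  moreover have "koszul br ip x y (T z) = (\<Sum>l\<in>UNIV. ip (T z) (f l) * koszul br ip x y (f l))" for x y z
    by (rule linear_expand[OF koszul_linear(3), unfolded real_scaleR_def])
  ultimately show ?thesis
    using assms[unfolded cky_with_iff, THEN conjunct2, THEN conjunct2, rule_format, of "f i" "f j" "f k"]
    by (simp add: sum.distrib)
qed

end

section \<open>Orthonormalisation and orthonormal frames in dimension five\<close>

lemma orthonormal_independent:
  assumes "inner_product ip" "finite S" "\<forall>a\<in>S. \<forall>b\<in>S. ip a b = (if a = b then 1 else 0)"
  shows "independent S"
proof (rule independent_if_scalars_zero[OF assms(2)])
  fix c x assume s: "(\<Sum>x\<in>S. c x *\<^sub>R x) = 0" and x: "x \<in> S"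
  have bil: "bilinear ip" using assms(1) by (simp add: inner_product_def)
  then have lin: "linear (ip x)" by (simp add: bilinear_def)
  have "0 = ip x (\<Sum>y\<in>S. c y *\<^sub>R y)" by (simp add: s bilinear_rzero[OF bil])
  also have "\<dots> = (\<Sum>y\<in>S. c y * ip x y)"
    by (simp add: linear_sum[OF lin] linear_scale[OF lin])
  also have "\<dots> = (\<Sum>y\<in>S. if y = x then c y else 0)"
    using assms(3) x by (intro sum.cong) auto
  also have "\<dots> = c x" using x assms(2) by simp
  finally show "c x = 0" by simp
qed

text \<open>The first span relation keeps the new vector in a given subspace such as the centre; the
  second locates \<open>v\<close> relative to the enlarged orthonormal set, which is how T Z1 is
  positioned later.\<close>

lemma gram_schmidt_step:
  assumes ip: "inner_product ip" and "finite S"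
    and S: "\<forall>a\<in>S. \<forall>b\<in>S. ip a b = (if a = b then 1 else 0)"
    and v: "v \<notin> span S"
  obtains u where "ip u u = 1" "\<And>a. a \<in> S \<Longrightarrow> ip u a = 0" "\<And>a. a \<in> S \<Longrightarrow> ip a u = 0"
    "u \<in> span (insert v S)" "v \<in> span (insert u S)"
proof -
  have bil: "bilinear ip" and sym: "ip x y = ip y x" and pos: "x \<noteq> 0 \<Longrightarrow> ip x x > 0" for x y
    using ip by (auto simp: inner_product_def)
  define p where "p = (\<Sum>a\<in>S. ip v a *\<^sub>R a)"
  define w where "w = v - p"
  define u where "u = (1 / sqrt (ip w w)) *\<^sub>R w"
  have p: "p \<in> span S" unfolding p_def by (intro span_sum span_scale span_base)
  then have "w \<noteq> 0" using v by (auto simp: w_def)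
  then have ww: "ip w w > 0" by (rule pos)
  have wa: "ip w a = 0" if "a \<in> S" for a
  proof -
    have lin: "linear (\<lambda>x. ip x a)" using bil by (simp add: bilinear_def)
    have "ip p a = (\<Sum>b\<in>S. ip v b * ip b a)"
      unfolding p_def by (simp add: linear_sum[OF lin] linear_scale[OF lin])
    also have "\<dots> = (\<Sum>b\<in>S. if b = a then ip v b else 0)"
      using S that by (intro sum.cong) auto
    also have "\<dots> = ip v a" using that \<open>finite S\<close> by simp
    finally show ?thesis by (simp add: w_def bilinear_lsub[OF bil])
  qed
  have w_eq: "v = sqrt (ip w w) *\<^sub>R u + p" using ww by (simp add: u_def w_def)
  show ?thesis
  proof
    show "ip u u = 1" using ww by (simp add: u_def bilinear_lmul[OF bil] bilinear_rmul[OF bil])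
    show "ip u a = 0" if "a \<in> S" for a by (simp add: u_def bilinear_lmul[OF bil] wa[OF that])
    then show "ip a u = 0" if "a \<in> S" for a using that sym by simp
    have pv: "p \<in> span (insert v S)" using p span_mono[of S "insert v S"] by auto
    show "u \<in> span (insert v S)"
      unfolding u_def w_def by (rule span_scale[OF span_diff[OF span_base pv]]) simp
    have "p \<in> span (insert u S)" using p span_mono[of S "insert u S"] by auto
    then show "v \<in> span (insert u S)"
      using span_add[OF span_scale[OF span_base[of u "insert u S"]]] w_eq by simp
  qed
qed

text \<open>A vector outside the span of the frame would yield a sixth orthonormal vector,
  contradicting dimension five.\<close>

lemma orthonormal_frame_expansion:
  fixes f :: "idx \<Rightarrow> 'a::real_vector"
  assumes ip: "inner_product ip" and dim: "dim (UNIV :: 'a set) = 5"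
    and on: "\<And>i j. ip (f i) (f j) = (if i = j then 1 else 0)"
  shows "v = (\<Sum>i\<in>UNIV. ip v (f i) *\<^sub>R f i)"
proof -
  have bil: "bilinear ip" and pos: "x \<noteq> 0 \<Longrightarrow> ip x x > 0" for x
    using ip by (auto simp: inner_product_def)
  have inj: "inj f" by (rule injI) (metis on zero_neq_one)
  have R: "\<forall>a\<in>range f. \<forall>b\<in>range f. ip a b = (if a = b then 1 else 0)"
    using on by (auto simp: inj_eq[OF inj])
  obtain B :: "'a set" where B: "UNIV \<subseteq> span B" "card B = 5"
    using basis_exists[of "UNIV :: 'a set"] dim by metis
  have "card (UNIV :: idx set) = 5" by (simp add: UNIV_idx)
  then have cR: "card (range f) = 5" using card_image[OF inj] by simp
  have span: "w \<in> span (range f)" for w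
  proof (rule ccontr)
    assume "w \<notin> span (range f)"
    then obtain u where u: "ip u u = 1" "\<And>a. a \<in> range f \<Longrightarrow> ip u a = 0"
        "\<And>a. a \<in> range f \<Longrightarrow> ip a u = 0"
      by (rule gram_schmidt_step[OF ip finite_imageI[OF finite] R]) blast
    have un: "u \<notin> range f" using u(1,2) by force
    have "independent (insert u (range f))"
      using R u un by (intro orthonormal_independent[OF ip]) auto
    moreover have "finite B" using B(2) card.infinite by fastforce
    ultimately have "card (insert u (range f)) \<le> card B"
      using independent_span_bound B(1) by blast
    then show False using un cR B(2) by simp
  qed
  \<comment> \<open>The remainder is orthogonal to the frame, hence to its span, hence to
    itself.\<close>
  define w where "w = v - (\<Sum>i\<in>UNIV. ip v (f i) *\<^sub>R f i)"
  have "ip w (f j) = 0" for j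
    by (cases j; simp add: w_def sum_idx bilinear_ladd[OF bil] bilinear_lmul[OF bil] bilinear_lsub[OF bil] on)
  then have "range f \<subseteq> {x. ip w x = 0}" by auto
  moreover have "subspace {x. ip w x = 0}"
    by (auto simp: subspace_def bilinear_radd[OF bil] bilinear_rmul[OF bil] bilinear_rzero[OF bil])
  ultimately have "ip w w = 0" using span[of w] span_minimal by blast
  then have "w = 0" using pos by force
  then show ?thesis by (simp add: w_def)
qed

subsection \<open>The normal form\<close>

text \<open>\<open>P\<close> and \<open>u\<close> become the parameters r and s of the models. The
  sign of \<open>a4 P u\<close>, the rotation speed of E on the X-Y plane, separates the three
  families.\<close>

locale normal_form = framed_algebra br ip f
  for br :: "'a::real_vector \<Rightarrow> 'a \<Rightarrow> 'a" and ip f +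
  fixes P u :: real
  assumes P_pos: "P > 0" and u_pos: "u > 0"
    and br_EX: "br (f iE) (f iX) = P *\<^sub>R f iZ1 + a4 P u *\<^sub>R f iY"
    and br_EY: "br (f iE) (f iY) = P *\<^sub>R f iZ2 - a4 P u *\<^sub>R f iX"
    and br_XY: "br (f iX) (f iY) = u *\<^sub>R f iE"
    and br_Z1: "br (f iZ1) v = 0" and br_Z2: "br (f iZ2) v = 0"
begin

abbreviation co :: "idx \<Rightarrow> 'a \<Rightarrow> real" where "co i v \<equiv> ip v (f i)"

lemma br_Z_right: "br v (f iZ1) = 0" "br v (f iZ2) = 0"
  using br_anti[of v] by (simp_all add: br_Z1 br_Z2)

lemma br_XE: "br (f iX) (f iE) = - P *\<^sub>R f iZ1 - a4 P u *\<^sub>R f iY"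
  and br_YE: "br (f iY) (f iE) = a4 P u *\<^sub>R f iX - P *\<^sub>R f iZ2"
  and br_YX: "br (f iY) (f iX) = - u *\<^sub>R f iE"
  using br_anti[of "f iX" "f iE"] br_anti[of "f iY" "f iE"] br_anti[of "f iY" "f iX"]
  by (simp_all add: br_EX br_EY br_XY)

lemmas br_frame = br_EX br_EY br_XY br_XE br_YE br_YX br_Z1 br_Z2 br_Z_right br_self

lemma br_formula:
  "br x y = wedge (co iE) (co iX) x y *\<^sub>R (P *\<^sub>R f iZ1 + a4 P u *\<^sub>R f iY)
     + wedge (co iE) (co iY) x y *\<^sub>R (P *\<^sub>R f iZ2 - a4 P u *\<^sub>R f iX)
     + (wedge (co iX) (co iY) x y * u) *\<^sub>R f iE"
proof -
  have "br x y = br (co iE x *\<^sub>R f iE + co iZ1 x *\<^sub>R f iZ1 + co iZ2 x *\<^sub>R f iZ2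
       + co iX x *\<^sub>R f iX + co iY x *\<^sub>R f iY)
     (co iE y *\<^sub>R f iE + co iZ1 y *\<^sub>R f iZ1 + co iZ2 y *\<^sub>R f iZ2
       + co iX y *\<^sub>R f iX + co iY y *\<^sub>R f iY)"
    by (simp only: expansion_idx[symmetric])
  then show ?thesis
    by (simp only: br_linear br_frame) (simp add: wedge_def algebra_simps)
qed

text \<open>The solution of the CKY equation in the frame, normalised so that its mixed terms have
  coefficient 1.\<close>

definition frame_form :: "'a \<Rightarrow> 'a \<Rightarrow> real" where
  "frame_form x y = (2 * P / u + u / P) * wedge (co iZ1) (co iZ2) x y
     + wedge (co iZ1) (co iX) x y + wedge (co iZ2) (co iY) x y
     + 2 * P / u * wedge (co iX) (co iY) x y"

text \<open>A single constant governs both T and \<theta>. Hence the CKY tensors form at most a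
  line, and as P > 0 a non-zero one is automatically strict.\<close>

lemma cky_imp_multiple:
  assumes T: "cky_with br ip T \<theta>"
  obtains c where "\<And>x y. ip (T x) y = c * frame_form x y"
    "\<And>x. \<theta> x = c * P / 2 * co iE x"
proof -
  have lin: "linear T" "linear \<theta>" and skew: "ip (T x) y = - ip x (T y)" for x y
    using T by (auto simp: cky_with_def skew_endo_def)
  define w where "w i j = ip (T (f i)) (f j)" for i j
  have w_anti: "w i j = - w j i" for i j
    using skew[of "f i" "f j"] ip_commute by (simp add: w_def)
  have w_self: "w i i = 0" for i using w_anti[of i i] by simp
  note w_flip = w_anti[of iZ1 iE] w_anti[of iZ2 iE] w_anti[of iX iE] w_anti[of iY iE]
    w_anti[of iZ2 iZ1] w_anti[of iX iZ1] w_anti[of iY iZ1] w_anti[of iX iZ2] w_anti[of iY iZ2]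
    w_anti[of iY iX] w_self
  note eq = cky_frame[OF T, folded w_def]
  note ev = sum_idx koszul_def br_frame ip_linear orthonormal
  have P: "P \<noteq> 0" "u \<noteq> 0" using P_pos u_pos by auto
  \<comment> \<open>First the coefficients absent from \<open>frame_form\<close>, and the values of
    \<theta> off E, are shown to vanish; the triples are chosen to isolate them.\<close>
  have a: "w iZ2 iX = 0" using eq[where i=iE and j=iX and k=iY] P by (simp add: ev w_flip)
  have b: "w iZ1 iY = 0" using eq[where i=iE and j=iY and k=iX] P by (simp add: ev w_flip)
  have t: "\<theta> (f iZ2) = 0" "\<theta> (f iY) = 0" "\<theta> (f iZ1) = 0" "\<theta> (f iX) = 0"
    using eq[where i=iZ1 and j=iZ1 and k=iZ2] eq[where i=iZ1 and j=iZ1 and k=iY]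
      eq[where i=iZ2 and j=iZ2 and k=iZ1] eq[where i=iZ2 and j=iZ2 and k=iX]
    by (simp_all add: ev w_flip)
  have e: "w iE iZ2 = 0" "w iE iZ1 = 0" "w iE iX = 0" "w iE iY = 0"
    using eq[where i=iZ1 and j=iZ2 and k=iX] eq[where i=iZ1 and j=iZ2 and k=iY]
      eq[where i=iX and j=iY and k=iZ2] eq[where i=iX and j=iY and k=iZ1] P
    by (simp_all add: ev w_flip)
  \<comment> \<open>The free parameter. Relations 1 to 4 form a triangular system giving
    \<open>\<theta> (f iE)\<close> and the three other coefficients in terms of it.\<close>
  define c where "c = w iZ1 iX"
  have 1: "P * c = 2 * \<theta> (f iE)"
    using eq[where i=iE and j=iZ1 and k=iZ1] by (simp add: ev w_flip c_def mult.commute)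
  have 2: "P * w iZ2 iY = 2 * \<theta> (f iE)"
    using eq[where i=iE and j=iZ2 and k=iZ2] by (simp add: ev w_flip mult.commute)
  have 3: "u * w iX iY = P * c + 2 * \<theta> (f iE)"
    using eq[where i=iE and j=iX and k=iX] by (simp add: ev w_flip c_def algebra_simps)
  have 4: "P * w iZ1 iZ2 = P * w iX iY + u * c"
    using eq[where i=iZ1 and j=iY and k=iE] by (simp add: ev w_flip c_def algebra_simps)
  have sol: "w iZ2 iY = c" "w iX iY = c * (2 * P / u)" "w iZ1 iZ2 = c * (2 * P / u + u / P)"
  proof -
    have "P * w iZ2 iY = P * c" using 1 2 by simp
    then show *: "w iZ2 iY = c" using P by simp
    have "u * w iX iY = u * (c * (2 * P / u))" using 1 3 P(2) by simp
    then show **: "w iX iY = c * (2 * P / u)" by (rule mult_left_cancel[OF P(2), THEN iffD1])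
    have "P * w iZ1 iZ2 = P * (c * (2 * P / u + u / P))"
      unfolding 4 ** using P by (simp add: field_simps)
    then show "w iZ1 iZ2 = c * (2 * P / u + u / P)"
      by (rule mult_left_cancel[OF P(1), THEN iffD1])
  qed
  show ?thesis
  proof
    fix x
    have "\<theta> x = (\<Sum>i\<in>UNIV. co i x * \<theta> (f i))"
      by (rule linear_expand[OF lin(2), unfolded real_scaleR_def])
    also have "\<dots> = co iE x * \<theta> (f iE)" by (simp add: sum_idx t)
    also have "\<theta> (f iE) = c * P / 2" using 1 by (simp add: mult.commute)
    also have "co iE x * (c * P / 2) = c * P / 2 * co iE x" by (rule mult.commute)
    finally show "\<theta> x = c * P / 2 * co iE x" .
    fix y
    have "T x = (\<Sum>i\<in>UNIV. co i x *\<^sub>R T (f i))" by (rule linear_expand[OF lin(1)])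
    then have "ip (T x) y = ip (\<Sum>i\<in>UNIV. co i x *\<^sub>R T (f i)) y" by (rule arg_cong)
    also have "\<dots> = (\<Sum>i\<in>UNIV. co i x * ip (T (f i)) y)"
      by (simp add: sum_idx ip_linear)
    also have "\<dots> = (\<Sum>i\<in>UNIV. co i x * (\<Sum>j\<in>UNIV. w i j * co j y))"
      by (simp add: ip_expand[of "T _" y] w_def)
    also have "\<dots> = c * frame_form x y"
      by (simp add: sum_idx w_flip a b e sol c_def[symmetric])
        (simp add: frame_form_def wedge_def algebra_simps)
    finally show "ip (T x) y = c * frame_form x y" .
  qed
qed

text \<open>The converse: the skew endomorphism with associated form \<open>frame_form\<close> does
  solve the equation, as a check on frame triples shows.\<close>

lemma strict_cky_exists: "\<exists>T. strict_cky_tensor br ip T"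
proof -
  define T where "T x = (\<Sum>j\<in>UNIV. frame_form x (f j) *\<^sub>R f j)" for x
  \<comment> \<open>The 1-form that \<open>cky_imp_multiple\<close> forces for c = 1.\<close>
  define \<theta> where "\<theta> x = P / 2 * co iE x" for x
  have "frame_form (x + y) z = frame_form x z + frame_form y z"
    "frame_form (a *\<^sub>R x) z = a * frame_form x z" for x y z a
    by (simp_all only: frame_form_def wedge_def ip_linear real_scaleR_def) algebra+
  then have "linear T" unfolding T_def
    by (auto intro!: linearI simp: sum.distrib scaleR_add_left scaleR_sum_right)
  moreover have T_form: "ip (T x) y = frame_form x y" for x y
    by (simp add: ip_expand[of "T x" y])
      (simp add: T_def sum_idx ip_linear orthonormal frame_form_def wedge_def algebra_simps)
  moreover have "ip x (T y) = - frame_form x y" for x y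
    unfolding ip_commute[of x] T_form by (simp add: frame_form_def wedge_def algebra_simps)
  ultimately have skew: "skew_endo ip T" by (simp add: skew_endo_def)
  have lin: "linear \<theta>" by (auto intro!: linearI simp: \<theta>_def ip_linear algebra_simps)
  have Tf: "T (f iE) = 0" 
    "T (f iZ1) = (2 * P / u + u / P) *\<^sub>R f iZ2 + f iX"
    "T (f iZ2) = - (2 * P / u + u / P) *\<^sub>R f iZ1 + f iY"
    "T (f iX) = - f iZ1 + (2 * P / u) *\<^sub>R f iY"
    "T (f iY) = - f iZ2 - (2 * P / u) *\<^sub>R f iX"
    by (simp_all add: T_def frame_form_def wedge_def sum_idx orthonormal)
  have "cky_with br ip T \<theta>"
  proof (rule cky_with_frameI[OF skew lin])
    fix i j k
    show "koszul br ip (f i) (T (f j)) (f k) + koszul br ip (f i) (f j) (T (f k))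
            + koszul br ip (f j) (T (f i)) (f k) + koszul br ip (f j) (f i) (T (f k))
        = 2 * (2 * ip (f i) (f j) * \<theta> (f k) - ip (f j) (f k) * \<theta> (f i) - ip (f i) (f k) * \<theta> (f j))"
      \<comment> \<open>The value of \<open>a4 P u\<close> matters here: the triple (E, Y, Z1), for
        instance, holds only because it equals u - P^2/u.\<close>
      using P_pos u_pos
      by (cases i; cases j; cases k; simp add: Tf \<theta>_def koszul_def br_linear br_frame ip_linear orthonormal;
        simp add: a4_def field_simps power2_eq_square)
  qed
  moreover have "\<theta> (f iE) \<noteq> 0" using P_pos by (simp add: \<theta>_def orthonormal)
  ultimately show ?thesis unfolding strict_cky_tensor_def by blast
qed

lemma strict_cky_form:
  assumes "strict_cky_tensor br ip T"
  obtains c where "c \<noteq> 0" "\<And>x y. assoc_form ip T x y = c * frame_form x y"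
proof -
  obtain \<theta> where \<theta>: "cky_with br ip T \<theta>" "\<exists>x. \<theta> x \<noteq> 0"
    using assms by (auto simp: strict_cky_tensor_def)
  obtain c where "\<And>x y. ip (T x) y = c * frame_form x y" "\<And>x. \<theta> x = c * P / 2 * co iE x"
    using cky_imp_multiple[OF \<theta>(1)] by metis
  with \<theta>(2) that[of c] show ?thesis by (force simp: assoc_form_def)
qed

text \<open>Both tensors have multiples of the same form, and a zero multiple would be the zero
  endomorphism.\<close>

lemma cky_unique:
  assumes "cky_tensor br ip T" "cky_tensor br ip T'" "T \<noteq> (\<lambda>x. 0)" "T' \<noteq> (\<lambda>x. 0)"
  shows "\<exists>c. c \<noteq> 0 \<and> T' = (\<lambda>x. c *\<^sub>R T x)"
proof -
  obtain c where c: "ip (T x) y = c * frame_form x y" for x y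
    using assms(1) cky_imp_multiple unfolding cky_tensor_def by metis
  obtain c' where c': "ip (T' x) y = c' * frame_form x y" for x y
    using assms(2) cky_imp_multiple unfolding cky_tensor_def by metis
  have "c \<noteq> 0" "c' \<noteq> 0"
    using assms(3,4) c c' vector_eqI[of _ 0] by (auto simp: ip_linear)
  moreover have "T' x = (c' / c) *\<^sub>R T x" for x
    by (rule vector_eqI) (use \<open>c \<noteq> 0\<close> in \<open>simp add: c c' ip_linear\<close>)
  ultimately show ?thesis by (intro exI[of _ "c' / c"]) auto
qed

end

section \<open>Isometries between normal forms and invariance of the two parameters\<close>

lemma normal_form_pullback:
  assumes g: "normal_form br' ip' g P u" and ip: "inner_product ip" and br: "lie_bracket br"
    and \<phi>: "isometric_isomorphism br ip br' ip' \<phi>"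
  obtains f where "normal_form br ip f P u" "\<And>i. \<phi> (f i) = g i"
proof -
  interpret g: normal_form br' ip' g P u by (rule g)
  have lin: "linear \<phi>" and bij: "bij \<phi>" and hom: "\<phi> (br x y) = br' (\<phi> x) (\<phi> y)"
    and iso: "ip x y = ip' (\<phi> x) (\<phi> y)" for x y
    using \<phi> by (auto simp: isometric_isomorphism_def)
  have inj: "\<phi> x = \<phi> y \<Longrightarrow> x = y" for x y using bij by (auto simp: bij_def dest: injD)
  note \<phi>_lin = linear_add[OF lin] linear_scale[OF lin] linear_neg[OF lin] linear_diff[OF lin]
    linear_0[OF lin]
  define f where "f i = inv \<phi> (g i)" for i
  have \<phi>f: "\<phi> (f i) = g i" for i using bij by (simp add: f_def bij_is_surj surj_f_inv_f)
  have "normal_form br ip f P u"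
  proof
    show "bilinear br" "br x x = 0" for x using br by (auto simp: lie_bracket_def)
    show "inner_product ip" by (rule ip)
    show "ip (f i) (f j) = (if i = j then 1 else 0)" for i j
      by (simp add: iso \<phi>f g.orthonormal)
    show "v = (\<Sum>i\<in>UNIV. ip v (f i) *\<^sub>R f i)" for v
      by (rule inj, subst g.expansion[of "\<phi> v"]) (simp add: linear_sum[OF lin] \<phi>_lin iso \<phi>f)
    show "P > 0" "u > 0" by (rule g.P_pos, rule g.u_pos)
    show "br (f iE) (f iX) = P *\<^sub>R f iZ1 + a4 P u *\<^sub>R f iY"
      "br (f iE) (f iY) = P *\<^sub>R f iZ2 - a4 P u *\<^sub>R f iX"
      "br (f iX) (f iY) = u *\<^sub>R f iE" "br (f iZ1) v = 0" "br (f iZ2) v = 0" for v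
      by (rule inj; simp add: hom \<phi>_lin \<phi>f g.br_frame)+
  qed
  with that \<phi>f show ?thesis by blast
qed

text \<open>The brackets of the frame involve only \<open>P\<close> and \<open>u\<close>, so
  matching coordinates in the two frames respects brackets as well as inner products.\<close>

lemma normal_form_isometric:
  assumes f: "normal_form br ip f P u" and g: "normal_form br' ip' g P u"
  shows "isometrically_isomorphic br ip br' ip'"
proof -
  interpret f: normal_form br ip f P u by (rule f)
  interpret g: normal_form br' ip' g P u by (rule g)
  define \<phi> where "\<phi> x = (\<Sum>i\<in>UNIV. ip x (f i) *\<^sub>R g i)" for x
  define \<psi> where "\<psi> y = (\<Sum>i\<in>UNIV. ip' y (g i) *\<^sub>R f i)" for y
  have co: "ip' (\<phi> x) (g i) = ip x (f i)" for x i
    by (cases i; simp add: \<phi>_def sum_idx g.ip_linear g.orthonormal)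
  have co': "ip (\<psi> y) (f i) = ip' y (g i)" for y i
    by (cases i; simp add: \<psi>_def sum_idx f.ip_linear f.orthonormal)
  have lin: "linear \<phi>"
    by (auto intro!: linearI g.vector_eqI simp: co f.ip_linear g.ip_linear)
  have "\<phi> (\<psi> y) = y" "\<psi> (\<phi> x) = x" for x y
    by (auto intro: f.vector_eqI g.vector_eqI simp: co co')
  then have "bij \<phi>" by (intro o_bij[of \<psi>]) auto
  moreover have "\<phi> (br x y) = br' (\<phi> x) (\<phi> y)" for x y
  proof -
    have "\<phi> (f i) = g i" for i
      by (rule g.vector_eqI) (simp add: co f.orthonormal g.orthonormal)
    then show ?thesis
      by (simp add: f.br_formula[of x y] g.br_formula[of "\<phi> x"] linear_add[OF lin] linear_diff[OF lin]
          linear_scale[OF lin] wedge_def co)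
  qed
  moreover have "ip' (\<phi> x) (\<phi> y) = ip x y" for x y
    by (simp add: f.ip_expand[of x y] g.ip_expand[of "\<phi> x"] co)
  ultimately show ?thesis
    using lin by (auto simp: isometrically_isomorphic_def isometric_isomorphism_def)
qed

text \<open>The centre is the span of the two central frame vectors, and E is recovered up to sign as the
  direction of the bracket of the other two vectors, being the only bracket of two orthogonal vectors
  of the orthogonal complement of the centre that has no central component.\<close>

lemma normal_form_parameters_unique:
  assumes f: "normal_form br ip f P u" and g: "normal_form br ip g P' u'"
  shows "P' = P \<and> u' = u"
proof -
  interpret f: normal_form br ip f P u by (rule f)
  interpret g: normal_form br ip g P' u' by (rule g)
  have pos: "P \<noteq> 0" "u \<noteq> 0" "P' \<noteq> 0" "u' \<noteq> 0" using f.P_pos f.u_pos g.P_pos g.u_pos by auto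
  \<comment> \<open>Since P is non-zero, the central components of [z, E] and [z, X] reveal the
    coordinates of z along E, X and Y.\<close>
  have ZI: "ip z (f iE) = 0 \<and> ip z (f iX) = 0 \<and> ip z (f iY) = 0" if z: "\<And>v. br z v = 0" for z
  proof -
    have "ip (br z (f iE)) (f iZ1) = 0" "ip (br z (f iE)) (f iZ2) = 0" "ip (br z (f iX)) (f iZ1) = 0"
      by (simp_all add: z f.ip_linear)
    then show ?thesis using pos
      by (simp add: f.br_formula wedge_def f.ip_linear f.orthonormal)
  qed
  have ZI': "ip z (g iE) = 0 \<and> ip z (g iX) = 0 \<and> ip z (g iY) = 0" if z: "\<And>v. br z v = 0" for z
  proof -
    have "ip (br z (g iE)) (g iZ1) = 0" "ip (br z (g iE)) (g iZ2) = 0" "ip (br z (g iX)) (g iZ1) = 0"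
      by (simp_all add: z g.ip_linear)
    then show ?thesis using pos
      by (simp add: g.br_formula wedge_def g.ip_linear g.orthonormal)
  qed
  have gE: "ip (g iE) (f iZ1) = 0" "ip (g iE) (f iZ2) = 0"
    and gX: "ip (g iX) (f iZ1) = 0" "ip (g iX) (f iZ2) = 0"
    and gY: "ip (g iY) (f iZ1) = 0" "ip (g iY) (f iZ2) = 0"
    using ZI'[of "f iZ1", OF f.br_Z1] ZI'[of "f iZ2", OF f.br_Z2] f.ip_commute[of "g _"] by auto
  define x where "x i = ip (g iX) (f i)" for i
  define y where "y i = ip (g iY) (f i)" for i
  define e where "e i = ip (g iE) (f i)" for i
  have z: "x iZ1 = 0" "x iZ2 = 0" "y iZ1 = 0" "y iZ2 = 0" "e iZ1 = 0" "e iZ2 = 0"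
    by (simp_all add: x_def y_def e_def gE gX gY)
  \<comment> \<open>This bracket is a multiple of \<open>g iE\<close>, which has no central part; so
    the E-X and E-Y minors of the coordinates of \<open>g iX\<close> and \<open>g iY\<close>
    vanish.\<close>
  have "ip (br (g iX) (g iY)) (f iZ1) = 0" "ip (br (g iX) (g iY)) (f iZ2) = 0"
    by (simp_all add: g.br_XY f.ip_linear gE)
  then have cross: "x iE * y iX = x iX * y iE" "x iE * y iY = x iY * y iE"
    using pos by (simp_all add: f.br_formula wedge_def f.ip_linear f.orthonormal x_def[symmetric]
        y_def[symmetric])
  have xx: "x iE * x iE + x iX * x iX + x iY * x iY = 1"
    and yy: "y iE * y iE + y iX * y iX + y iY * y iY = 1"
    and xy: "x iE * y iE + x iX * y iX + x iY * y iY = 0"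
    using f.ip_expand[of "g iX" "g iX"] f.ip_expand[of "g iY" "g iY"] f.ip_expand[of "g iX" "g iY"]
    by (simp_all add: sum_idx g.orthonormal x_def[symmetric] y_def[symmetric] z)
  \<comment> \<open>The vanishing minors together with orthonormality force \<open>g iX\<close> and
    \<open>g iY\<close> to have no E-coordinate.\<close>
  have "x iE * (y iE * y iE + y iX * y iX + y iY * y iY)
      = y iE * (x iE * y iE + x iX * y iX + x iY * y iY)"
    using cross by algebra
  then have xE: "x iE = 0" using xy yy by simp
  have "y iE * (x iE * x iE + x iX * x iX + x iY * x iY)
      = x iE * (x iE * y iE + x iX * y iX + x iY * y iY)"
    using cross by algebra
  then have yE: "y iE = 0" using xx xy by simp
  \<comment> \<open>Lagrange's identity: the remaining 2 by 2 minor is 1 or -1. Hence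
    \<open>g iE\<close> is \<open>f iE\<close> up to sign, and u is determined up to sign.\<close>
  have "(x iX * y iY - x iY * y iX)^2
      = (x iX * x iX + x iY * x iY) * (y iX * y iX + y iY * y iY) - (x iX * y iX + x iY * y iY)^2"
    by (simp add: power2_eq_square algebra_simps)
  then have det: "(x iX * y iY - x iY * y iX)^2 = 1"
    using xx yy xy xE yE by simp
  have "ip (br (g iX) (g iY)) (f i) = u' * e i" for i
    by (simp add: g.br_XY f.ip_linear e_def)
  from this[of iE] this[of iX] this[of iY]
  have uE: "u * (x iX * y iY - x iY * y iX) = u' * e iE" and eX: "e iX = 0" and eY: "e iY = 0"
    using pos by (simp_all add: f.br_formula wedge_def f.ip_linear f.orthonormal x_def[symmetric]
        y_def[symmetric] xE yE mult_ac)
  have eE: "(e iE)^2 = 1"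
    using f.ip_expand[of "g iE" "g iE"]
    by (simp add: sum_idx g.orthonormal e_def[symmetric] z eX eY power2_eq_square)
  have "(u * (x iX * y iY - x iY * y iX))^2 = (u' * e iE)^2" by (simp only: uE)
  then have "u^2 = u'^2" by (simp add: power_mult_distrib det eE)
  then have u: "u' = u" using f.u_pos g.u_pos by simp
  have gZ: "ip (g iZ1) (f iE) = 0" "ip (g iZ1) (f iX) = 0" "ip (g iZ1) (f iY) = 0"
    using ZI[of "g iZ1", OF g.br_Z1] by auto
  \<comment> \<open>The squared length of the central part of this bracket is P^2 in one frame and
    P'^2 in the other.\<close>
  have "ip (br (g iE) (g iX)) (f iZ1) = P' * ip (g iZ1) (f iZ1)"
    "ip (br (g iE) (g iX)) (f iZ2) = P' * ip (g iZ1) (f iZ2)"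
    by (simp_all add: g.br_EX f.ip_linear gY)
  then have PZ: "P * (e iE * x iX) = P' * ip (g iZ1) (f iZ1)" "P * (e iE * x iY) = P' * ip (g iZ1) (f iZ2)"
    by (simp_all add: f.br_formula wedge_def f.ip_linear f.orthonormal x_def[symmetric]
        e_def[symmetric] xE eX eY mult_ac)
  have Z: "(ip (g iZ1) (f iZ1))^2 + (ip (g iZ1) (f iZ2))^2 = 1"
    using f.ip_expand[of "g iZ1" "g iZ1"]
    by (simp add: sum_idx g.orthonormal gZ power2_eq_square)
  have "(x iX)^2 + (x iY)^2 = 1" using xx xE by (simp add: power2_eq_square)
  then have "P^2 = P^2 * (e iE)^2 * ((x iX)^2 + (x iY)^2)" by (simp add: eE)
  also have "\<dots> = (P * (e iE * x iX))^2 + (P * (e iE * x iY))^2"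
    by (simp add: power_mult_distrib algebra_simps)
  also have "\<dots> = P'^2 * ((ip (g iZ1) (f iZ1))^2 + (ip (g iZ1) (f iZ2))^2)"
    by (simp only: PZ) (simp add: power_mult_distrib algebra_simps)
  also have "\<dots> = P'^2" by (simp add: Z)
  finally have "P^2 = P'^2" .
  then show ?thesis using u f.P_pos g.P_pos by simp
qed

subsection \<open>From a strict CKY tensor to the normal form\<close>

context framed_algebra
begin

text \<open>The frame equations are solved for T and the brackets at once. Diagonal equations
  containing \<open>\<theta> (f iE)\<close> show that certain coefficients are non-zero; these serve
  as pivots by which the other equations are divided. Signs are left open.\<close>

lemma adapted_frame_structure:
  assumes cky: "cky_with br ip T \<theta>"
    and Z1: "\<And>v. br (f iZ1) v = 0" and Z2: "\<And>v. br (f iZ2) v = 0"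
    and \<theta>: "\<theta> (f iE) \<noteq> 0" "\<theta> (f iZ1) = 0" "\<theta> (f iZ2) = 0" "\<theta> (f iX) = 0" "\<theta> (f iY) = 0"
    and TY: "ip (T (f iZ1)) (f iY) = 0"
  obtains P Q K u where "P \<noteq> 0" "u \<noteq> 0" "Q^2 = P^2" "u * (u - K) = P^2"
    "br (f iE) (f iX) = P *\<^sub>R f iZ1 + K *\<^sub>R f iY"
    "br (f iE) (f iY) = Q *\<^sub>R f iZ2 - K *\<^sub>R f iX"
    "br (f iX) (f iY) = u *\<^sub>R f iE"
proof -
  have Zr: "br v (f iZ1) = 0" "br v (f iZ2) = 0" for v
    using br_anti[of v] by (simp_all add: Z1 Z2)
  have skew: "ip (T x) y = - ip x (T y)" for x y
    using cky by (auto simp: cky_with_def skew_endo_def)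
  define w where "w i j = ip (T (f i)) (f j)" for i j
  have w_anti: "w i j = - w j i" for i j
    using skew[of "f i" "f j"] ip_commute by (simp add: w_def)
  have w_self: "w i i = 0" for i using w_anti[of i i] by simp
  define p q r where "p i = ip (br (f iE) (f iX)) (f i)" and "q i = ip (br (f iE) (f iY)) (f i)"
    and "r i = ip (br (f iX) (f iY)) (f i)" for i
  define t a m n k b l g h d where "t = \<theta> (f iE)"
    and "a = w iZ1 iZ2" and "m = w iZ1 iX" and "n = w iZ2 iX" and "k = w iZ2 iY" and "b = w iZ1 iE"
    and "l = w iZ2 iE" and "g = w iE iX" and "h = w iE iY" and "d = w iX iY"
  \<comment> \<open>The choice of Y orthogonal to T Z1 removes this unknown.\<close>
  have 0: "w iZ1 iY = 0" "w iY iZ1 = 0" using TY w_anti[of iY iZ1] by (simp_all add: w_def)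
  have w: "w iZ1 iZ2 = a" "w iZ2 iZ1 = - a" "w iZ1 iX = m" "w iX iZ1 = - m" "w iZ2 iX = n"
    "w iX iZ2 = - n" "w iZ2 iY = k" "w iY iZ2 = - k" "w iZ1 iE = b" "w iE iZ1 = - b"
    "w iZ2 iE = l" "w iE iZ2 = - l" "w iE iX = g" "w iX iE = - g" "w iE iY = h" "w iY iE = - h"
    "w iX iY = d" "w iY iX = - d" "w i i = 0" for i
    using w_anti[of iZ2 iZ1] w_anti[of iX iZ1] w_anti[of iX iZ2] w_anti[of iY iZ2] w_anti[of iE iZ1]
      w_anti[of iE iZ2] w_anti[of iX iE] w_anti[of iY iE] w_anti[of iY iX] w_self
    by (simp_all add: a_def m_def n_def k_def b_def l_def g_def h_def d_def)
  have brf: "br (f iX) (f iE) = - br (f iE) (f iX)" "br (f iY) (f iE) = - br (f iE) (f iY)"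
    "br (f iY) (f iX) = - br (f iX) (f iY)"
    by (rule br_anti)+
  note ev = sum_idx koszul_def brf br_self Z1 Z2 Zr ip_linear orthonormal w 0 \<theta>(2-)
    p_def[symmetric] q_def[symmetric] r_def[symmetric] t_def[symmetric]
  note eq = cky_frame[OF cky, folded w_def]
  have t: "t \<noteq> 0" using \<theta> by (simp add: t_def)
  \<comment> \<open>The first pivots: both factors are non-zero because t is.\<close>
  have mp: "m * p iZ1 = 2 * t"
    using eq[where i=iE and j=iZ1 and k=iZ1] by (simp add: ev)
  with t have mp0: "m \<noteq> 0" "p iZ1 \<noteq> 0" by auto
  have b0: "b = 0"
    using eq[where i=iZ1 and j=iX and k=iZ1] mp0 by (simp add: ev)
  have r1: "r iZ1 = 0"
    using eq[where i=iZ1 and j=iY and k=iZ1] mp0 by (simp add: ev b0)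
  have g0: "g = 0"
    using eq[where i=iZ1 and j=iX and k=iX] mp0 by (simp add: ev b0 r1)
  have l0: "l = 0"
    using eq[where i=iZ1 and j=iZ2 and k=iX] mp0 by (simp add: ev b0 r1)
  have r2: "r iZ2 = 0"
    using eq[where i=iZ1 and j=iY and k=iZ2] mp0 by (simp add: ev b0 r1 l0)
  \<comment> \<open>The two equations differ by three times \<open>m * p iZ2\<close>, so this
    product vanishes.\<close>
  have "k * q iZ1 + m * p iZ2 + n * p iZ1 = 0"
    using eq[where i=iZ1 and j=iZ2 and k=iE] by (simp add: ev algebra_simps)
  moreover have "k * q iZ1 - 2 * (m * p iZ2) + n * p iZ1 = 0"
    using eq[where i=iE and j=iZ2 and k=iZ1] by (simp add: ev algebra_simps)
  ultimately have "m * p iZ2 = 0" and kn': "k * q iZ1 + m * p iZ2 + n * p iZ1 = 0" by linarith+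
  then have p2: "p iZ2 = 0" and kn: "k * q iZ1 + n * p iZ1 = 0" using mp0 by auto
  have kq: "k * q iZ2 = 2 * t"
    using eq[where i=iE and j=iZ2 and k=iZ2] by (simp add: ev p2)
  with t have kq0: "k \<noteq> 0" "q iZ2 \<noteq> 0" by auto
  \<comment> \<open>Again two equations in the same two products, which must therefore both
    vanish.\<close>
  have "h * p iZ1 + 2 * (m * r iX) = 0"
    using eq[where i=iX and j=iY and k=iZ1] by (simp add: ev b0 g0 algebra_simps)
  moreover have "h * p iZ1 + m * r iX = 0"
    using eq[where i=iZ1 and j=iX and k=iY] by (simp add: ev b0 g0 r2 algebra_simps)
  ultimately have "h * p iZ1 = 0" "m * r iX = 0" by linarith+
  then have h0: "h = 0" and r3: "r iX = 0" using mp0 by auto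
  have r4: "r iY = 0"
    using eq[where i=iZ1 and j=iY and k=iY] mp0 by (simp add: ev b0 r1 h0)
  have p0: "p iE = 0"
    using eq[where i=iE and j=iZ1 and k=iE] mp0 by (simp add: ev g0 h0)
  have q0: "q iE = 0"
    using eq[where i=iE and j=iZ2 and k=iE] kq0 by (simp add: ev g0 h0 p0)
  \<comment> \<open>The sum of these two equations says that E acts skewly on the X-Y plane; the
    difference gives \<open>d * r iE = 4 * t\<close>, so [X, Y] is non-zero.\<close>
  have d1: "d * (p iY + q iX + r iE) = 4 * t"
    using eq[where i=iE and j=iX and k=iX] mp by (simp add: ev p2 h0 algebra_simps)
  have d2: "d * (p iY + q iX - r iE) = - 4 * t"
    using eq[where i=iE and j=iY and k=iY] kq by (simp add: ev g0 algebra_simps)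
  have d0: "d \<noteq> 0" using d1 t by auto
  have q1: "q iZ1 = 0"
    using eq[where i=iE and j=iZ1 and k=iX] d0 by (simp add: ev p2 b0 h0)
  have n0: "n = 0" using kn q1 mp0 by simp
  have p3: "p iX = 0"
    using eq[where i=iE and j=iX and k=iZ1] mp0 by (simp add: ev b0 h0 q1)
  have "d * (p iY + q iX) = 0" using d1 d2 by (simp add: algebra_simps)
  then have q3: "q iX = - p iY" using d0 by (simp add: eq_neg_iff_add_eq_0 add.commute)
  have dr: "d * r iE = 4 * t" using d1 q3 by simp
  then have r0: "r iE \<noteq> 0" using t by auto
  have q4: "q iY = 0"
    using eq[where i=iE and j=iY and k=iX] d0 by (simp add: ev b0 l0 g0 h0 p2)
  \<comment> \<open>Multiplying by \<open>r iE\<close> and replacing \<open>d * r iE\<close> by 4t,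
    that is by \<open>2 * m * p iZ1\<close> or \<open>2 * k * q iZ2\<close>, leaves the quadratic
    relations between the structure constants.\<close>
  have dp: "d * p iZ1 = 2 * m * (r iE - p iY)"
    using eq[where i=iE and j=iY and k=iZ1] by (simp add: ev b0 g0 algebra_simps)
  have dq: "d * q iZ2 = 2 * k * (r iE - p iY)"
    using eq[where i=iE and j=iX and k=iZ2] by (simp add: ev l0 h0 n0 q3 algebra_simps)
  have "2 * m * (r iE * (r iE - p iY)) = 2 * m * (p iZ1)^2" using dp dr mp by algebra
  then have P2: "r iE * (r iE - p iY) = (p iZ1)^2" using mp0 by simp
  have "2 * k * (r iE * (r iE - p iY)) = 2 * k * (q iZ2)^2" using dq dr kq by algebra
  then have Q2: "r iE * (r iE - p iY) = (q iZ2)^2" using kq0 by simp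
  show ?thesis
  proof
    show "p iZ1 \<noteq> 0" "r iE \<noteq> 0" "(q iZ2)^2 = (p iZ1)^2" "r iE * (r iE - p iY) = (p iZ1)^2"
      using mp0 r0 P2 Q2 by auto
    show "br (f iE) (f iX) = p iZ1 *\<^sub>R f iZ1 + p iY *\<^sub>R f iY"
      using expansion_idx[of "br (f iE) (f iX)"] by (simp add: p_def[symmetric] p0 p2 p3)
    show "br (f iE) (f iY) = q iZ2 *\<^sub>R f iZ2 - p iY *\<^sub>R f iX"
      using expansion_idx[of "br (f iE) (f iY)"] by (simp add: q_def[symmetric] q0 q1 q3 q4)
    show "br (f iX) (f iY) = r iE *\<^sub>R f iE"
      using expansion_idx[of "br (f iX) (f iY)"] by (simp add: r_def[symmetric] r1 r2 r3 r4)
  qed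
qed

end

lemma framed_algebraI:
  fixes f :: "idx \<Rightarrow> 'a::real_vector"
  assumes "metric_lie_algebra br ip" "dim (UNIV :: 'a set) = 5"
    and "\<And>i j. ip (f i) (f j) = (if i = j then 1 else 0)"
  shows "framed_algebra br ip f"
proof
  have ip: "inner_product ip" and br: "lie_bracket br"
    using assms(1) by (auto simp: metric_lie_algebra_def)
  show "bilinear br" "br x x = 0" "inner_product ip" for x
    using ip br by (auto simp: lie_bracket_def)
  show "ip (f i) (f j) = (if i = j then 1 else 0)" for i j by (rule assms(3))
  show "v = (\<Sum>i\<in>UNIV. ip v (f i) *\<^sub>R f i)" for v
    by (rule orthonormal_frame_expansion[OF ip assms(2,3)])
qed

text \<open>E comes from the vector dual to \<theta>, X from the part of T Z1 outside the centre
  plane and E; a provisional frame through Z1 and Z2 gives access to the Koszul form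
  beforehand.\<close>

lemma adapted_frame_exists:
  fixes br :: "'a::real_vector \<Rightarrow> 'a \<Rightarrow> 'a"
  assumes mla: "metric_lie_algebra br ip" and dim: "dim (UNIV :: 'a set) = 5"
    and center: "dim (lie_center br) > 1"
    and cky: "cky_with br ip T \<theta>" and strict: "\<theta> x0 \<noteq> 0"
  obtains f where "framed_algebra br ip f" "\<And>v. br (f iZ1) v = 0" "\<And>v. br (f iZ2) v = 0"
    "\<theta> (f iE) \<noteq> 0" "\<theta> (f iZ1) = 0" "\<theta> (f iZ2) = 0" "\<theta> (f iX) = 0" "\<theta> (f iY) = 0"
    "ip (T (f iZ1)) (f iY) = 0"
proof -
  have ip: "inner_product ip" and br: "lie_bracket br"
    using mla by (auto simp: metric_lie_algebra_def)
  have bilb: "bilinear br" using br by (simp add: lie_bracket_def)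
  have pos: "x \<noteq> 0 \<Longrightarrow> ip x x > 0" for x
    using ip by (auto simp: inner_product_def)
  have sub: "subspace (lie_center br)"
    by (auto simp: subspace_def lie_center_def bilinear_ladd[OF bilb] bilinear_lmul[OF bilb]
        bilinear_lzero[OF bilb])
  have outside: "\<exists>v. v \<notin> span S" if "finite S" "card S < 5" for S :: "'a set"
    using dim_le_card[of UNIV S] that dim by force
  have in_center: "\<exists>v\<in>lie_center br. v \<notin> span S" if "finite S" "card S \<le> 1" for S
    using dim_le_card[of "lie_center br" S] that center by force
  obtain v1 where v1: "v1 \<in> lie_center br" "v1 \<notin> span {}" using in_center[of "{}"] by auto
  obtain z1 where z1: "ip z1 z1 = 1" "z1 \<in> span {v1}"
    using gram_schmidt_step[OF ip finite.emptyI _ v1(2)] by auto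
  have z1c: "z1 \<in> lie_center br" using span_minimal[of "{v1}", OF _ sub] v1 z1 by auto
  obtain v2 where v2: "v2 \<in> lie_center br" "v2 \<notin> span {z1}" using in_center[of "{z1}"] by auto
  obtain z2 where z2: "ip z2 z2 = 1" "ip z2 z1 = 0" "ip z1 z2 = 0" "z2 \<in> span {v2, z1}"
    by (rule gram_schmidt_step[OF ip _ _ v2(2)]) (use z1 in auto)
  have z2c: "z2 \<in> lie_center br" using span_minimal[of "{v2, z1}", OF _ sub] v2 z1c z2 by auto
  have cen: "br z1 v = 0" "br z2 v = 0" for v using z1c z2c by (auto simp: lie_center_def)
  have card: "card {z1, z2} < 5" "card {z1, z2, a} < 5" "card {z1, z2, a, b} < 5" for a b
    by (simp_all add: card_insert_if)
  note on = z1 z2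
  \<comment> \<open>Arbitrary completion to the provisional frame.\<close>
  obtain v3 where v3: "v3 \<notin> span {z1, z2}" using outside[OF _ card(1)] by auto
  obtain g3 where g3: "ip g3 g3 = 1" "ip g3 z1 = 0" "ip g3 z2 = 0" "ip z1 g3 = 0" "ip z2 g3 = 0"
    by (rule gram_schmidt_step[OF ip _ _ v3]) (use on in auto)
  obtain v4 where v4: "v4 \<notin> span {z1, z2, g3}" using outside[OF _ card(2)] by auto
  obtain g4 where g4: "ip g4 g4 = 1" "ip g4 z1 = 0" "ip g4 z2 = 0" "ip g4 g3 = 0"
    "ip z1 g4 = 0" "ip z2 g4 = 0" "ip g3 g4 = 0"
    by (rule gram_schmidt_step[OF ip _ _ v4]) (use on g3 in auto)
  obtain v5 where v5: "v5 \<notin> span {z1, z2, g3, g4}" using outside[OF _ card(3)] by auto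
  obtain g5 where g5: "ip g5 g5 = 1" "ip g5 z1 = 0" "ip g5 z2 = 0" "ip g5 g3 = 0" "ip g5 g4 = 0"
    "ip z1 g5 = 0" "ip z2 g5 = 0" "ip g3 g5 = 0" "ip g4 g5 = 0"
    by (rule gram_schmidt_step[OF ip _ _ v5]) (use on g3 g4 in auto)
  define g where "g i = (case i of iE \<Rightarrow> g3 | iZ1 \<Rightarrow> z1 | iZ2 \<Rightarrow> z2 | iX \<Rightarrow> g4 | iY \<Rightarrow> g5)" for i
  interpret g: framed_algebra br ip g
    by (rule framed_algebraI[OF mla dim])
      (auto simp: g_def on g3 g4 g5 split: idx.splits)
  have cen': "br v z1 = 0" "br v z2 = 0" for v using g.br_anti[of v] cen by auto
  have lin: "linear \<theta>" using cky by (simp add: cky_with_def)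
  have kosz: "koszul br ip x (T y) z + koszul br ip x y (T z)
            + koszul br ip y (T x) z + koszul br ip y x (T z)
        = 2 * (2 * ip x y * \<theta> z - ip y z * \<theta> x - ip x z * \<theta> y)" for x y z
    using cky by (simp add: g.cky_with_iff)
  \<comment> \<open>For orthonormal central vectors the left side vanishes and the right side is
    four times \<theta> of the third argument.\<close>
  have \<theta>z: "\<theta> z1 = 0" "\<theta> z2 = 0"
    using kosz[of z1 z1 z2] kosz[of z2 z2 z1]
    by (simp_all add: koszul_def cen cen' g.ip_linear on)
  \<comment> \<open>The vector representing \<theta> with respect to the inner product.\<close>
  define \<xi> where "\<xi> = (\<Sum>i\<in>UNIV. \<theta> (g i) *\<^sub>R g i)"
  have \<xi>: "ip \<xi> v = \<theta> v" for v
    using g.linear_expand[OF lin, of v] g.ip_commute[of _ v]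
    by (simp add: \<xi>_def sum_idx g.ip_linear mult.commute)
  have "\<xi> \<noteq> 0" using strict \<xi>[of x0] by (auto simp: g.ip_linear)
  then have N: "ip \<xi> \<xi> > 0" by (rule pos)
  define e where "e = (1 / sqrt (ip \<xi> \<xi>)) *\<^sub>R \<xi>"
  have e1: "ip e e = 1" using N by (simp add: e_def g.ip_linear)
  have ez: "ip e z1 = 0" "ip e z2 = 0" "ip z1 e = 0" "ip z2 e = 0"
    using \<theta>z g.ip_commute[of _ \<xi>] by (simp_all add: e_def g.ip_linear \<xi>)
  have \<theta>e: "\<theta> v = sqrt (ip \<xi> \<xi>) * ip e v" for v
    using N by (simp add: e_def g.ip_linear \<xi>)
  have \<theta>e0: "\<theta> e \<noteq> 0" using N by (simp add: \<theta>e e1)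
  \<comment> \<open>Otherwise [T z1, e] = 0, and the equation at (z1, z1, e) would give
    \<open>\<theta> e = 0\<close>.\<close>
  have Tz: "T z1 \<notin> span {z1, z2, e}"
  proof
    assume "T z1 \<in> span {z1, z2, e}"
    moreover have "subspace {v. br v e = 0}"
      by (auto simp: subspace_def g.br_linear)
    ultimately have "br (T z1) e = 0"
      using span_minimal[of "{z1, z2, e}" "{v. br v e = 0}"] by (auto simp: cen g.br_self)
    then show False
      using kosz[of z1 z1 e] \<theta>e0 by (simp add: koszul_def cen cen' g.ip_linear on ez)
  qed
  \<comment> \<open>By the second span relation T z1 has no component beyond z1, z2, e and x; the
    last vector y is then orthogonal to it.\<close>
  obtain x where x: "ip x x = 1" "ip x z1 = 0" "ip x z2 = 0" "ip x e = 0"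
    "ip z1 x = 0" "ip z2 x = 0" "ip e x = 0" and Tx: "T z1 \<in> span {x, z1, z2, e}"
    by (rule gram_schmidt_step[OF ip _ _ Tz]) (use on e1 ez in auto)
  obtain v where v: "v \<notin> span {z1, z2, e, x}" using outside[OF _ card(3)] by auto
  obtain y where y: "ip y y = 1" "ip y z1 = 0" "ip y z2 = 0" "ip y e = 0" "ip y x = 0"
    "ip z1 y = 0" "ip z2 y = 0" "ip e y = 0" "ip x y = 0"
    by (rule gram_schmidt_step[OF ip _ _ v]) (use on x e1 ez in auto)
  have "subspace {v. ip v y = 0}" by (auto simp: subspace_def g.ip_linear)
  then have Ty: "ip (T z1) y = 0"
    using Tx span_minimal[of "{x, z1, z2, e}" "{v. ip v y = 0}"] y by auto
  define f where "f i = (case i of iE \<Rightarrow> e | iZ1 \<Rightarrow> z1 | iZ2 \<Rightarrow> z2 | iX \<Rightarrow> x | iY \<Rightarrow> y)" for i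
  show ?thesis
  proof (rule that[of f])
    show "framed_algebra br ip f"
      by (rule framed_algebraI[OF mla dim])
        (auto simp: f_def on e1 ez x y split: idx.splits)
  qed (auto simp: f_def cen \<theta>z \<theta>e0 \<theta>e[of x] \<theta>e[of y] x y Ty)
qed

lemma strict_cky_imp_normal_form:
  fixes br :: "'a::real_vector \<Rightarrow> 'a \<Rightarrow> 'a"
  assumes mla: "metric_lie_algebra br ip" and dim: "dim (UNIV :: 'a set) = 5"
    and center: "dim (lie_center br) > 1" and T: "strict_cky_tensor br ip T"
  obtains f P u where "normal_form br ip f P u"
proof -
  obtain \<theta> x0 where cky: "cky_with br ip T \<theta>" "\<theta> x0 \<noteq> 0"
    using T by (auto simp: strict_cky_tensor_def)
  obtain f where f: "framed_algebra br ip f" "\<And>v. br (f iZ1) v = 0" "\<And>v. br (f iZ2) v = 0"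
    "\<theta> (f iE) \<noteq> 0" "\<theta> (f iZ1) = 0" "\<theta> (f iZ2) = 0" "\<theta> (f iX) = 0" "\<theta> (f iY) = 0"
    "ip (T (f iZ1)) (f iY) = 0"
    using adapted_frame_exists[OF mla dim center cky] by blast
  interpret f: framed_algebra br ip f by (rule f(1))
  obtain P Q K u where P: "P \<noteq> 0" "u \<noteq> 0" "Q^2 = P^2" "u * (u - K) = P^2"
    and b: "br (f iE) (f iX) = P *\<^sub>R f iZ1 + K *\<^sub>R f iY"
      "br (f iE) (f iY) = Q *\<^sub>R f iZ2 - K *\<^sub>R f iX"
      "br (f iX) (f iY) = u *\<^sub>R f iE"
    by (rule f.adapted_frame_structure[OF cky(1) f(2-)]) blast
  \<comment> \<open>Flipping E by the sign of u makes the coefficient of [X, Y] positive; the signs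
    on Z1 and Z2 then make both central coefficients equal to the absolute value of P, which is also
    that of Q.\<close>
  define s where "s = sgn u"
  define g where "g i = (case i of iE \<Rightarrow> s *\<^sub>R f iE | iZ1 \<Rightarrow> (s * sgn P) *\<^sub>R f iZ1
    | iZ2 \<Rightarrow> (s * sgn Q) *\<^sub>R f iZ2 | iX \<Rightarrow> f iX | iY \<Rightarrow> f iY)" for i
  have Q: "\<bar>Q\<bar> = \<bar>P\<bar>" "Q \<noteq> 0" using P by (auto simp: power2_eq_iff)
  have sg: "s * s = 1" "sgn P * sgn P = 1" "sgn Q * sgn Q = 1" "s * u = \<bar>u\<bar>"
    "s * \<bar>u\<bar> = u" "sgn P * \<bar>P\<bar> = P" "sgn Q * \<bar>Q\<bar> = Q"
    using P(1,2) Q(2) by (auto simp: s_def sgn_if)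
  have K: "a4 \<bar>P\<bar> \<bar>u\<bar> = s * K"
  proof -
    have "(u\<^sup>2 - P\<^sup>2) = u * K" using P(4) by (simp add: power2_eq_square algebra_simps)
    then have "a4 \<bar>P\<bar> \<bar>u\<bar> = u * K / \<bar>u\<bar>" by (simp add: a4_def)
    also have "\<dots> = s * K" using P(2) by (simp add: s_def sgn_if)
    finally show ?thesis .
  qed
  interpret g: framed_algebra br ip g
  proof (rule framed_algebraI[OF mla dim])
    have "s * sgn P * (s * sgn P) = 1" "s * sgn Q * (s * sgn Q) = 1"
      using P(1,2) Q(2) by (auto simp: s_def sgn_if)
    then show "ip (g i) (g j) = (if i = j then 1 else 0)" for i j
      by (cases i; cases j; simp add: g_def f.ip_linear f.orthonormal sg)
  qed
  have "normal_form br ip g \<bar>P\<bar> \<bar>u\<bar>"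
  proof
    show "\<bar>P\<bar> > 0" "\<bar>u\<bar> > 0" using P by auto
    have "P = \<bar>P\<bar> * sgn P" "Q = \<bar>P\<bar> * sgn Q"
      using sg(6,7) Q(1) by (simp_all add: mult.commute)
    then show "br (g iE) (g iX) = \<bar>P\<bar> *\<^sub>R g iZ1 + a4 \<bar>P\<bar> \<bar>u\<bar> *\<^sub>R g iY"
      "br (g iE) (g iY) = \<bar>P\<bar> *\<^sub>R g iZ2 - a4 \<bar>P\<bar> \<bar>u\<bar> *\<^sub>R g iX"
      by (simp_all add: g_def f.br_linear b K scaleR_add_right scaleR_diff_right)
    show "br (g iX) (g iY) = \<bar>u\<bar> *\<^sub>R g iE"
      using sg(5) by (simp add: g_def b mult.commute)
    show "br (g iZ1) v = 0" "br (g iZ2) v = 0" for v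
      by (simp_all add: g_def f.br_linear f(2,3))
  qed
  then show ?thesis by (rule that)
qed

subsection \<open>The models\<close>

text \<open>The parameters of the normal form of a model. Admissibility places the families on P =
  u, P < u and P > u, so the positive quadrant is covered exactly once.\<close>

fun model_P :: "model \<Rightarrow> real" where
  "model_P (L59 r) = r"
| "model_P (R2_su2 r s) = r"
| "model_P (R2_sl2 r s) = r"

fun model_u :: "model \<Rightarrow> real" where
  "model_u (L59 r) = r"
| "model_u (R2_su2 r s) = s"
| "model_u (R2_sl2 r s) = s"

lemma model_exists:
  assumes "P > 0" "u > 0"
  obtains m where "admissible m" "model_P m = P" "model_u m = u"
proof -
  consider "P = u" | "P < u" | "u < P" by linarith
  then show ?thesis
    by cases (use assms that[of "L59 P"] that[of "R2_su2 P u"] that[of "R2_sl2 P u"] in auto)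
qed

lemma model_unique:
  assumes "admissible m" "admissible m'" "model_P m = model_P m'" "model_u m = model_u m'"
  shows "m = m'"
  using assms by (cases m; cases m') auto

lemma normal_form_modelI:
  assumes m: "admissible m"
    and on: "\<And>i j. model_metric m (f i) (f j) = (if i = j then 1 else 0)"
    and "P > 0" "u > 0"
    and "model_bracket m (f iE) (f iX) = P *\<^sub>R f iZ1 + a4 P u *\<^sub>R f iY"
    and "model_bracket m (f iE) (f iY) = P *\<^sub>R f iZ2 - a4 P u *\<^sub>R f iX"
    and "model_bracket m (f iX) (f iY) = u *\<^sub>R f iE"
    and "\<And>v. model_bracket m (f iZ1) v = 0" "\<And>v. model_bracket m (f iZ2) v = 0"
  shows "normal_form (model_bracket m) (model_metric m) f P u"
proof -
  have "dim (UNIV :: vec5 set) = 5" by (simp add: UNIV_idx)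
  then interpret framed_algebra "model_bracket m" "model_metric m" f
    by (rule framed_algebraI[OF metric_lie_algebra_model[OF m] _ on])
  show ?thesis using assms(3-) by unfold_locales
qed

lemma wedge_linear:
  "wedge (\<lambda>v. a v + b v) c x y = wedge a c x y + wedge b c x y"
  "wedge (\<lambda>v. a v - b v) c x y = wedge a c x y - wedge b c x y"
  "wedge (\<lambda>v. - a v) c x y = - wedge a c x y"
  "wedge (\<lambda>v. k * a v) c x y = k * wedge a c x y"
  "wedge (\<lambda>v. a v / k) c x y = wedge a c x y / k"
  "wedge c (\<lambda>v. a v + b v) x y = wedge c a x y + wedge c b x y"
  "wedge c (\<lambda>v. a v - b v) x y = wedge c a x y - wedge c b x y"
  "wedge c (\<lambda>v. - a v) x y = - wedge c a x y"
  "wedge c (\<lambda>v. k * a v) x y = k * wedge c a x y"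
  "wedge c (\<lambda>v. a v / k) x y = wedge c a x y / k"
  by (simp_all add: wedge_def ring_distribs diff_divide_distrib)

lemma wedge_flip: "wedge a b x y = - wedge b a x y"
  by (simp add: wedge_def)

section \<open>Explicit normal-form frames of the three models\<close>

lemma model_normal_form_L59:
  assumes r: "r > 0"
  obtains f c where "normal_form (model_bracket (L59 r)) (model_metric (L59 r)) f r r" "c \<noteq> 0"
    "\<And>x y. model_form (L59 r) x y = c * normal_form.frame_form (model_metric (L59 r)) f r r x y"
proof -
  \<comment> \<open>Normalised basis vectors; the minus signs arise because the table prescribes
    [X, E] and [Y, E] while the normal form uses [E, X] and [E, Y].\<close>
  define f where "f i = (case i of iE \<Rightarrow> (1 / r) *\<^sub>R bvec iE | iZ1 \<Rightarrow> (- 1 / r^2) *\<^sub>R bvec iZ1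
    | iZ2 \<Rightarrow> (- 1 / r^2) *\<^sub>R bvec iZ2 | iX \<Rightarrow> bvec iX | iY \<Rightarrow> bvec iY)" for i
  interpret normal_form "model_bracket (L59 r)" "model_metric (L59 r)" f r r
  proof (rule normal_form_modelI)
    show "admissible (L59 r)" "r > 0" "r > 0" using r by auto
    show "model_metric (L59 r) (f i) (f j) = (if i = j then 1 else 0)" for i j
      using r by (cases i; cases j;
        simp add: f_def metric_of_def sum_idx axis_def power2_eq_square power4_eq_xxxx)
  qed (use r in \<open>simp_all add: f_def a4_def bracket_of_def vec_eq_iff all_idx sum_idx axis_def
    power2_eq_square\<close>)
  have co: "co iE = (\<lambda>v. v $ iE * r)" "co iZ1 = (\<lambda>v. - (r^2 * v $ iZ1))"
    "co iZ2 = (\<lambda>v. - (r^2 * v $ iZ2))" "co iX = (\<lambda>v. v $ iX)" "co iY = (\<lambda>v. v $ iY)"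
    using r by (auto simp: fun_eq_iff f_def metric_of_def sum_idx axis_def power2_eq_square power4_eq_xxxx)
  have "model_form (L59 r) x y = 2 / r * frame_form x y" for x y
    using r unfolding frame_form_def co
    by (simp add: wedge_linear) (simp add: field_simps eval_nat_numeral)
  then show ?thesis using that[of f "2 / r"] normal_form_axioms r by simp
qed

lemma model_normal_form_su2:
  assumes rs: "s > r" "r > 0"
  defines "m \<equiv> R2_su2 r s"
  obtains f c where "normal_form (model_bracket m) (model_metric m) f r s" "c \<noteq> 0"
    "\<And>x y. model_form m x y = c * normal_form.frame_form (model_metric m) f r s x y"
proof -
  \<comment> \<open>With this root the radicals disappear: \<open>a4 r s\<close> is k^2/s, the root
    in the metric is k^3/s and the power in the form is k^3.\<close>
  define k where "k = sqrt (s^2 - r^2)"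
  have "r^2 < s^2" using rs by (simp add: power_strict_mono)
  then have k: "k > 0" and k2: "s^2 - r^2 = k^2" by (simp_all add: k_def)
  have s: "s > 0" using rs by simp
  have a: "a4 r s = k^2 / s" by (simp add: a4_def k2)
  have k32: "(s^2 - r^2) powr (3/2) = k^3"
    unfolding k2 using k by (simp add: powr_powr powr_numeral[symmetric] del: powr_numeral)
  have sq: "sqrt ((a4 r s)^3 * s) = k^3 / s"
  proof (rule real_sqrt_unique)
    show "(k^3 / s)^2 = (a4 r s)^3 * s"
      using s by (simp add: a power_divide power2_eq_square power3_eq_cube)
  qed (use k s in simp)
  define q where "q = r * s / k^3"
  define l where "l = (r^2 * s^2 + k^4) / k^6"
  have G: "model_metric m x y = s^2 / k^4 * (x $ iE * y $ iE) + x $ iZ1 * y $ iZ1 + x $ iZ2 * y $ iZ2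
    + l * (x $ iX * y $ iX + x $ iY * y $ iY) + q * (x $ iZ1 * y $ iX + x $ iX * y $ iZ1)
    - q * (x $ iZ2 * y $ iY + x $ iY * y $ iZ2)" for x y
  proof -
    have "(r^2 + (a4 r s)^2) / ((a4 r s)^3 * s) = l" "1 / (a4 r s)^2 = s^2 / k^4"
      "r / sqrt ((a4 r s)^3 * s) = q"
      using k s unfolding sq by (simp_all add: a l_def q_def field_simps eval_nat_numeral)
    then show ?thesis
      by (simp add: m_def metric_of_def sum_idx algebra_simps)
  qed
  \<comment> \<open>X and Y are projected off the centre and rescaled; the projections have squared
    length l - q^2 = 1/k^2. Projecting Y adds a multiple of Z2, so [E, X] = Y acquires a Z2-part:
    this is why the first central vector is -Z2.\<close>
  define f where "f i = (case i of iE \<Rightarrow> (k^2 / s) *\<^sub>R bvec iE | iZ1 \<Rightarrow> - bvec iZ2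
    | iZ2 \<Rightarrow> - bvec iZ1 | iX \<Rightarrow> k *\<^sub>R bvec iX - (k * q) *\<^sub>R bvec iZ1
    | iY \<Rightarrow> k *\<^sub>R bvec iY + (k * q) *\<^sub>R bvec iZ2)" for i
  have l: "l - q^2 = 1 / k^2"
    using k by (simp add: l_def q_def power_divide) (simp add: field_simps eval_nat_numeral)
  have co: "model_metric m v (f iE) = s / k^2 * v $ iE"
    "model_metric m v (f iZ1) = q * v $ iY - v $ iZ2"
    "model_metric m v (f iZ2) = - (v $ iZ1 + q * v $ iX)"
    "model_metric m v (f iX) = v $ iX / k"
    "model_metric m v (f iY) = v $ iY / k" for v
  proof -
    have "model_metric m v (f iX) = k * (l - q^2) * v $ iX"
      "model_metric m v (f iY) = k * (l - q^2) * v $ iY"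
      by (simp_all add: G f_def axis_def algebra_simps power2_eq_square)
    moreover have "k * (l - q^2) = 1 / k" unfolding l using k by (simp add: power2_eq_square)
    ultimately show "model_metric m v (f iX) = v $ iX / k" "model_metric m v (f iY) = v $ iY / k"
      by simp_all
    show "model_metric m v (f iE) = s / k^2 * v $ iE"
      using k s by (simp add: G f_def axis_def field_simps eval_nat_numeral)
  qed (simp_all add: G f_def axis_def algebra_simps)
  interpret normal_form "model_bracket m" "model_metric m" f r s
  proof (rule normal_form_modelI)
    show "admissible m" "r > 0" "s > 0" using rs by (auto simp: m_def)
    show "model_metric m (f i) (f j) = (if i = j then 1 else 0)" for i j
      using k s by (cases i; cases j; simp only: co; simp add: f_def axis_def)
    show "model_bracket m (f iE) (f iX) = r *\<^sub>R f iZ1 + a4 r s *\<^sub>R f iY"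
      "model_bracket m (f iE) (f iY) = r *\<^sub>R f iZ2 - a4 r s *\<^sub>R f iX"
      "model_bracket m (f iX) (f iY) = s *\<^sub>R f iE"
      "model_bracket m (f iZ1) v = 0" "model_bracket m (f iZ2) v = 0" for v
      using k s by (simp_all add: a m_def f_def bracket_of_def vec_eq_iff all_idx sum_idx axis_def q_def)
       (simp_all add: field_simps eval_nat_numeral)
  qed
  \<comment> \<open>The factor is read off from the coefficients of z^1 and z^2; the other two then
    agree by k^2 = s^2 - r^2.\<close>
  have "model_form m x y = - (2 / r) * frame_form x y" for x y
  proof -
    let ?W = "\<lambda>i j. wedge (dual i) (dual j) x y"
    have "frame_form x y = - (2 * r / s + s / r) * ?W iZ1 iZ2
      + ((2 * r / s + s / r) * q - 1 / k) * (?W iZ1 iY + ?W iZ2 iX)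
      + ((2 * r / s + s / r) * q^2 - 2 * q / k + 2 * r / s / k^2) * ?W iX iY"
      unfolding frame_form_def co
      by (simp add: wedge_linear wedge_flip[of "dual iX" "dual iZ1"] wedge_flip[of "dual iX" "dual iZ2"]
          wedge_flip[of "dual iY" "dual iZ1"] wedge_flip[of "dual iY" "dual iZ2"]
          wedge_flip[of "dual iY" "dual iX"] wedge_flip[of "dual iZ2" "dual iZ1"])
        (simp add: wedge_def algebra_simps power2_eq_square diff_divide_distrib add_divide_distrib)
    moreover have "2 * (s^2 + 2 * r^2) / (r^2 * s) = 2 / r * (2 * r / s + s / r)"
      using rs s by (simp add: field_simps power2_eq_square)
    moreover have "6 * r / k^3 = 2 / r * ((2 * r / s + s / r) * q - 1 / k)"
    proof -
      have "2 / r * ((2 * r / s + s / r) * q - 1 / k) = 2 / r * (2 * r^2 + s^2 - k^2) / k^3"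
        using rs s k by (simp add: q_def field_simps eval_nat_numeral)
      also have "\<dots> = 6 * r / k^3"
        using rs by (simp add: k2[symmetric] power2_eq_square[of r])
      finally show ?thesis by simp
    qed
    moreover have "2 * (s^4 + 2 * r^4) / (s * (s^2 - r^2)^3)
      = 2 / r * ((2 * r / s + s / r) * q^2 - 2 * q / k + 2 * r / s / k^2)"
    proof -
      have "2 / r * ((2 * r / s + s / r) * q^2 - 2 * q / k + 2 * r / s / k^2)
        = 2 * (2 * r^2 * s^2 + s^4 - 2 * s^2 * k^2 + 2 * k^4) / (s * k^6)"
        using rs s k by (simp add: q_def field_simps eval_nat_numeral)
      also have "2 * r^2 * s^2 + s^4 - 2 * s^2 * k^2 + 2 * k^4 = s^4 + 2 * r^4"
        using k2 by algebra
      also have "k^6 = (s^2 - r^2)^3" unfolding k2 by (simp add: power_mult[symmetric])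
      finally show ?thesis by simp
    qed
    moreover have lin: "R * A * w - R * B * w' - R * C * w'' = - R * (- A * w + B * w' + C * w'')"
      for R A B C w w' w'' :: real by algebra
    ultimately show ?thesis
      by (simp only: m_def model_form.simps k32 lin)
  qed
  then show ?thesis using that[of f "- (2 / r)"] normal_form_axioms rs by simp
qed

lemma model_normal_form_sl2:
  assumes rs: "r > s" "s > 0"
  defines "m \<equiv> R2_sl2 r s"
  obtains f c where "normal_form (model_bracket m) (model_metric m) f r s" "c \<noteq> 0"
    "\<And>x y. model_form m x y = c * normal_form.frame_form (model_metric m) f r s x y"
proof -
  \<comment> \<open>Here \<open>a4 r s\<close> is negative, so k^2 is its numerator with the
    opposite sign.\<close>
  define k where "k = sqrt (r^2 - s^2)"
  have "s^2 < r^2" using rs by (simp add: power_strict_mono)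
  then have k: "k > 0" and k2: "r^2 - s^2 = k^2" by (simp_all add: k_def)
  have s: "s > 0" using rs by simp
  have k2': "s^2 - r^2 = - (k^2)" using k2 by simp
  have a: "a4 r s = - (k^2 / s)" by (simp add: a4_def k2')
  have k32: "(r^2 - s^2) powr (3/2) = k^3"
    unfolding k2 using k by (simp add: powr_powr powr_numeral[symmetric] del: powr_numeral)
  have sq: "sqrt (\<bar>a4 r s\<bar>^3 * s) = k^3 / s"
  proof (rule real_sqrt_unique)
    show "(k^3 / s)^2 = \<bar>a4 r s\<bar>^3 * s"
      using s by (simp add: a power_divide power2_eq_square power3_eq_cube)
  qed (use k s in simp)
  define q where "q = r * s / k^3"
  define l where "l = (r^2 * s^2 + k^4) / k^6"
  have G: "model_metric m x y = s^2 / k^4 * (x $ iE * y $ iE) + x $ iZ1 * y $ iZ1 + x $ iZ2 * y $ iZ2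
    + l * (x $ iX * y $ iX + x $ iY * y $ iY) + q * (x $ iZ1 * y $ iX + x $ iX * y $ iZ1)
    + q * (x $ iZ2 * y $ iY + x $ iY * y $ iZ2)" for x y
  proof -
    have "(r^2 + (a4 r s)^2) / (\<bar>a4 r s\<bar>^3 * s) = l" "1 / (a4 r s)^2 = s^2 / k^4"
      "r / sqrt (\<bar>a4 r s\<bar>^3 * s) = q"
      using k s unfolding sq by (simp_all add: a l_def q_def field_simps eval_nat_numeral)
    then show ?thesis
      by (simp add: m_def metric_of_def sum_idx algebra_simps)
  qed
  \<comment> \<open>As [X, Y] = -E in this algebra, E must be reversed for the coefficient s of
    [X, Y] to be positive.\<close>
  define f where "f i = (case i of iE \<Rightarrow> (- (k^2 / s)) *\<^sub>R bvec iE | iZ1 \<Rightarrow> - bvec iZ2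
    | iZ2 \<Rightarrow> bvec iZ1 | iX \<Rightarrow> k *\<^sub>R bvec iX - (k * q) *\<^sub>R bvec iZ1
    | iY \<Rightarrow> k *\<^sub>R bvec iY - (k * q) *\<^sub>R bvec iZ2)" for i
  have l: "l - q^2 = 1 / k^2"
    using k by (simp add: l_def q_def power_divide) (simp add: field_simps eval_nat_numeral)
  have co: "model_metric m v (f iE) = - (s / k^2) * v $ iE"
    "model_metric m v (f iZ1) = - (v $ iZ2 + q * v $ iY)"
    "model_metric m v (f iZ2) = v $ iZ1 + q * v $ iX"
    "model_metric m v (f iX) = v $ iX / k"
    "model_metric m v (f iY) = v $ iY / k" for v
  proof -
    have "model_metric m v (f iX) = k * (l - q^2) * v $ iX"
      "model_metric m v (f iY) = k * (l - q^2) * v $ iY"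
      by (simp_all add: G f_def axis_def algebra_simps power2_eq_square)
    moreover have "k * (l - q^2) = 1 / k" unfolding l using k by (simp add: power2_eq_square)
    ultimately show "model_metric m v (f iX) = v $ iX / k" "model_metric m v (f iY) = v $ iY / k"
      by simp_all
    show "model_metric m v (f iE) = - (s / k^2) * v $ iE"
      using k s by (simp add: G f_def axis_def field_simps eval_nat_numeral)
  qed (simp_all add: G f_def axis_def algebra_simps)
  interpret normal_form "model_bracket m" "model_metric m" f r s
  proof (rule normal_form_modelI)
    show "admissible m" "r > 0" "s > 0" using rs by (auto simp: m_def)
    show "model_metric m (f i) (f j) = (if i = j then 1 else 0)" for i j
      using k s by (cases i; cases j; simp only: co; simp add: f_def axis_def)
    show "model_bracket m (f iE) (f iX) = r *\<^sub>R f iZ1 + a4 r s *\<^sub>R f iY"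
      "model_bracket m (f iE) (f iY) = r *\<^sub>R f iZ2 - a4 r s *\<^sub>R f iX"
      "model_bracket m (f iX) (f iY) = s *\<^sub>R f iE"
      "model_bracket m (f iZ1) v = 0" "model_bracket m (f iZ2) v = 0" for v
      using k s by (simp_all add: a m_def f_def bracket_of_def vec_eq_iff all_idx sum_idx axis_def q_def)
       (simp_all add: field_simps eval_nat_numeral)
  qed
  have "model_form m x y = 2 / r * frame_form x y" for x y
  proof -
    let ?W = "\<lambda>i j. wedge (dual i) (dual j) x y"
    have "frame_form x y = (2 * r / s + s / r) * ?W iZ1 iZ2
      + ((2 * r / s + s / r) * q + 1 / k) * (?W iZ1 iY - ?W iZ2 iX)
      + ((2 * r / s + s / r) * q^2 + 2 * q / k + 2 * r / s / k^2) * ?W iX iY"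
      unfolding frame_form_def co
      by (simp add: wedge_linear wedge_flip[of "dual iX" "dual iZ1"] wedge_flip[of "dual iX" "dual iZ2"]
          wedge_flip[of "dual iY" "dual iZ1"] wedge_flip[of "dual iY" "dual iZ2"]
          wedge_flip[of "dual iY" "dual iX"] wedge_flip[of "dual iZ2" "dual iZ1"])
        (simp add: wedge_def algebra_simps power2_eq_square diff_divide_distrib add_divide_distrib)
    moreover have "2 * (s^2 + 2 * r^2) / (r^2 * s) = 2 / r * (2 * r / s + s / r)"
      using rs s by (simp add: field_simps power2_eq_square)
    moreover have "6 * r / k^3 = 2 / r * ((2 * r / s + s / r) * q + 1 / k)"
    proof -
      have "2 / r * ((2 * r / s + s / r) * q + 1 / k) = 2 / r * (2 * r^2 + s^2 + k^2) / k^3"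
        using rs s k by (simp add: q_def field_simps eval_nat_numeral)
      also have "\<dots> = 6 * r / k^3"
        using rs by (simp add: k2[symmetric] power2_eq_square[of r])
      finally show ?thesis by simp
    qed
    \<comment> \<open>The sign is absorbed because (s^2 - r^2)^3 is -k^6.\<close>
    moreover have "- (2 * (s^4 + 2 * r^4) / (s * (s^2 - r^2)^3))
      = 2 / r * ((2 * r / s + s / r) * q^2 + 2 * q / k + 2 * r / s / k^2)"
    proof -
      have "2 / r * ((2 * r / s + s / r) * q^2 + 2 * q / k + 2 * r / s / k^2)
        = 2 * (2 * r^2 * s^2 + s^4 + 2 * s^2 * k^2 + 2 * k^4) / (s * k^6)"
        using rs s k by (simp add: q_def field_simps eval_nat_numeral)
      also have "2 * r^2 * s^2 + s^4 + 2 * s^2 * k^2 + 2 * k^4 = s^4 + 2 * r^4"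
        using k2 by algebra
      also have "s * k^6 = - (s * (s^2 - r^2)^3)" unfolding k2' by (simp add: power_mult[symmetric])
      finally show ?thesis by simp
    qed
    ultimately show ?thesis
      by (simp only: m_def model_form.simps k32) algebra
  qed
  then show ?thesis using that[of f "2 / r"] normal_form_axioms rs by simp
qed

lemma model_normal_form:
  assumes "admissible m"
  obtains f c where "normal_form (model_bracket m) (model_metric m) f (model_P m) (model_u m)" "c \<noteq> 0"
    "\<And>x y. model_form m x y
      = c * normal_form.frame_form (model_metric m) f (model_P m) (model_u m) x y"
proof (cases m)
  case (L59 r)
  then show ?thesis using assms model_normal_form_L59[of r] that by auto
next
  case (R2_su2 r s)
  then show ?thesis using assms model_normal_form_su2[of r s] that by auto
next
  case (R2_sl2 r s)
  then show ?thesis using assms model_normal_form_sl2[of s r] that by auto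
qed

section \<open>Transfer of the form to the given algebra, and the classification\<close>

lemma strict_cky_form_pullback:
  assumes "admissible m" and ip: "inner_product ip" and br: "lie_bracket br"
    and \<phi>: "isometric_isomorphism br ip (model_bracket m) (model_metric m) \<phi>"
    and T: "strict_cky_tensor br ip T"
  shows "\<exists>c. c \<noteq> 0 \<and> (\<forall>x y. assoc_form ip T x y = c * model_form m (\<phi> x) (\<phi> y))"
proof -
  obtain g d where g: "normal_form (model_bracket m) (model_metric m) g (model_P m) (model_u m)"
    and d: "d \<noteq> 0" "\<And>x y. model_form m x y
      = d * normal_form.frame_form (model_metric m) g (model_P m) (model_u m) x y"
    by (rule model_normal_form[OF assms(1)]) blast
  obtain f where f: "normal_form br ip f (model_P m) (model_u m)" and fg: "\<And>i. \<phi> (f i) = g i"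
    by (rule normal_form_pullback[OF g ip br \<phi>]) blast
  obtain c where c: "c \<noteq> 0"
    "\<And>x y. assoc_form ip T x y = c * normal_form.frame_form ip f (model_P m) (model_u m) x y"
    by (rule normal_form.strict_cky_form[OF f T]) blast
  \<comment> \<open>As \<phi> is an isometry matching the frames, coordinates agree, so the two
    frame forms correspond under \<phi>.\<close>
  have "ip x (f i) = model_metric m (\<phi> x) (g i)" for x i
    using \<phi> by (simp add: isometric_isomorphism_def fg[symmetric])
  then have "normal_form.frame_form ip f (model_P m) (model_u m) x y
      = normal_form.frame_form (model_metric m) g (model_P m) (model_u m) (\<phi> x) (\<phi> y)" for x y
    by (simp add: normal_form.frame_form_def[OF f] normal_form.frame_form_def[OF g] wedge_def)
  then show ?thesis
    using c d by (intro exI[of _ "c / d"]) simp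
qed

theorem theorem5p4:
  shows
    "(\<forall>(br :: 'a::real_vector \<Rightarrow> 'a \<Rightarrow> 'a) ip.
        metric_lie_algebra br ip \<and> dim (UNIV :: 'a set) = 5 \<and> dim (lie_center br) > 1 \<and>
        (\<exists>T. strict_cky_tensor br ip T)
      \<longrightarrow>
        (\<exists>!m. admissible m \<and>
              isometrically_isomorphic br ip (model_bracket m) (model_metric m)) \<and>
        (\<forall>T T'. cky_tensor br ip T \<and> cky_tensor br ip T' \<and> T \<noteq> (\<lambda>x. 0) \<and> T' \<noteq> (\<lambda>x. 0)
           \<longrightarrow> (\<exists>c::real. c \<noteq> 0 \<and> T' = (\<lambda>x. c *\<^sub>R T x))) \<and>
        (\<forall>m \<phi> T. admissible m \<and>
              isometric_isomorphism br ip (model_bracket m) (model_metric m) \<phi> \<and>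
              strict_cky_tensor br ip T
           \<longrightarrow> (\<exists>c::real. c \<noteq> 0 \<and>
                  (\<forall>x y. assoc_form ip T x y = c * model_form m (\<phi> x) (\<phi> y)))))
     \<and>
     (\<forall>m. admissible m \<longrightarrow>
        (\<exists>T. strict_cky_tensor (model_bracket m) (model_metric m) T) \<and>
        (\<forall>T. strict_cky_tensor (model_bracket m) (model_metric m) T
           \<longrightarrow> (\<exists>c::real. c \<noteq> 0 \<and>
                  (\<forall>x y. assoc_form (model_metric m) T x y = c * model_form m x y))))"
proof (intro conjI allI impI)
  fix br :: "'a \<Rightarrow> 'a \<Rightarrow> 'a" and ip
  assume "metric_lie_algebra br ip \<and> dim (UNIV :: 'a set) = 5 \<and> dim (lie_center br) > 1 \<and>
        (\<exists>T. strict_cky_tensor br ip T)"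
  then have mla: "metric_lie_algebra br ip" and hyps: "dim (UNIV :: 'a set) = 5"
    "dim (lie_center br) > 1" and "\<exists>T. strict_cky_tensor br ip T"
    by auto
  then obtain f P u where f: "normal_form br ip f P u"
    using strict_cky_imp_normal_form[OF mla hyps] by metis
  have ip: "inner_product ip" and br: "lie_bracket br"
    using mla by (auto simp: metric_lie_algebra_def)
  interpret normal_form br ip f P u by (rule f)
  show "\<exists>!m. admissible m \<and> isometrically_isomorphic br ip (model_bracket m) (model_metric m)"
  proof (rule ex_ex1I)
    obtain m where m: "admissible m" "model_P m = P" "model_u m = u"
      by (rule model_exists[OF P_pos u_pos])
    obtain g where "normal_form (model_bracket m) (model_metric m) g (model_P m) (model_u m)"
      by (rule model_normal_form[OF m(1)]) blast
    then have "isometrically_isomorphic br ip (model_bracket m) (model_metric m)"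
      using normal_form_isometric[OF f] m by simp
    with m show "\<exists>m. admissible m \<and> isometrically_isomorphic br ip (model_bracket m) (model_metric m)"
      by blast
    \<comment> \<open>Pulling the frame of the model back gives a second normal form on the same
      algebra, whose parameters must coincide with the first.\<close>
    have par: "model_P m = P \<and> model_u m = u"
      if m: "admissible m \<and> isometrically_isomorphic br ip (model_bracket m) (model_metric m)" for m
    proof -
      obtain \<phi> where \<phi>: "isometric_isomorphism br ip (model_bracket m) (model_metric m) \<phi>"
        using m by (auto simp: isometrically_isomorphic_def)
      obtain g where g: "normal_form (model_bracket m) (model_metric m) g (model_P m) (model_u m)"
        by (rule model_normal_form[OF conjunct1[OF m]]) blast
      obtain h where "normal_form br ip h (model_P m) (model_u m)"
        by (rule normal_form_pullback[OF g ip br \<phi>]) blast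
      then show ?thesis by (rule normal_form_parameters_unique[OF f])
    qed
    show "m = m'"
      if "admissible m \<and> isometrically_isomorphic br ip (model_bracket m) (model_metric m)"
        "admissible m' \<and> isometrically_isomorphic br ip (model_bracket m') (model_metric m')" for m m'
      using that par[OF that(1)] par[OF that(2)] by (intro model_unique) auto
  qed
  show "\<exists>c. c \<noteq> 0 \<and> T' = (\<lambda>x. c *\<^sub>R T x)"
    if "cky_tensor br ip T \<and> cky_tensor br ip T' \<and> T \<noteq> (\<lambda>x. 0) \<and> T' \<noteq> (\<lambda>x. 0)" for T T'
    using that cky_unique[of T T'] by simp
  show "\<exists>c. c \<noteq> 0 \<and> (\<forall>x y. assoc_form ip T x y = c * model_form m (\<phi> x) (\<phi> y))"
    if "admissible m \<and> isometric_isomorphism br ip (model_bracket m) (model_metric m) \<phi> \<and>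
      strict_cky_tensor br ip T" for m \<phi> T
    using that strict_cky_form_pullback[OF _ ip br, of m \<phi> T] by simp
next
  fix m assume m: "admissible m"
  obtain g where "normal_form (model_bracket m) (model_metric m) g (model_P m) (model_u m)"
    by (rule model_normal_form[OF m]) blast
  then show "\<exists>T. strict_cky_tensor (model_bracket m) (model_metric m) T"
    by (rule normal_form.strict_cky_exists)
  \<comment> \<open>The identity specialises the transfer result to the model itself.\<close>
  have "isometric_isomorphism (model_bracket m) (model_metric m) (model_bracket m) (model_metric m) id"
    by (auto simp: isometric_isomorphism_def linear_id)
  note model_id = strict_cky_form_pullback[OF m inner_product_model[OF m] lie_bracket_model this]
  show "\<exists>c. c \<noteq> 0 \<and> (\<forall>x y. assoc_form (model_metric m) T x y = c * model_form m x y)"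
    if "strict_cky_tensor (model_bracket m) (model_metric m) T" for T
    using model_id[OF that] by simp
qed

end
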